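(* Let $f$ be a Hecke-holomorphic or Hecke-Maass cusp form for $\mathrm{SL}(2,\mathbb{Z})$ with normalized Fourier coefficients $\mathcal{A}_f(n)$. For every (arbitrarily small) $\varepsilon>0$ there is a constant $C=C(f,\varepsilon)>0$ such that for all real $X,Y\geqslant 1$ with $Y<X^{1-\varepsilon}$ and all sequences of complex numbers $\mathsf{a}(n)$, $\mathsf{b}(m)$, $$\left|\sum_{1\leqslant n\leqslant X}\ \sum_{1\leqslant m\leqslant Y}\mathsf{a}(n)\,\mathsf{b}(m)\,\mathcal{A}_f(n+m)\right|\leqslant C\,\|\mathsf{a}\|_2\,\|\mathsf{b}\|_2\,\frac{X^{3/8}}{Y^{3/4}}\,(XY)^{1/2+\varepsilon}.$$ This bound is non-trivial in the range $X^{1/2}<Y<X^{1-\varepsilon}$, i.e. there the factor $X^{3/8}/Y^{3/4}$, by which it differs from the trivial bound $\|\mathsf{a}\|_2\|\mathsf{b}\|_2(XY)^{1/2+\varepsilon}$, is less than $1$.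
   Context: Fourier coefficients: write $e(x)=e^{2\pi i x}$. If $f$ is a primitive holomorphic Hecke eigen-cusp form of integral weight $\kappa$ for $\mathrm{SL}(2,\mathbb{Z})$, the $\mathcal{A}_f(n)$ are defined by $f(z)=\sum_{n\geqslant 1}\mathcal{A}_f(n)n^{(\kappa-1)/2}e(nz)$ with $\mathcal{A}_f(1)=1$. If $f$ is a primitive Hecke-Maass cusp form for $\mathrm{SL}(2,\mathbb{Z})$ with Laplace eigenvalue $\tfrac14+\nu^2$, they are defined by $f(x+iy)=2\sqrt{y}\sum_{n\neq 0}\mathcal{A}_f(n)K_{i\nu}(2\pi|n|y)e(nx)$ with $\mathcal{A}_f(1)=1$, where $K_{i\nu}$ is the $K$-Bessel function. The Euclidean norms are $\|\mathsf{a}\|_2=\big(\sum_{1\leqslant n\leqslant X}|\mathsf{a}(n)|^2\big)^{1/2}$ and $\|\mathsf{b}\|_2=\big(\sum_{1\leqslant m\leqslant Y}|\mathsf{b}(m)|^2\big)^{1/2}$. *)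

theory Defs
  imports "HOL-Complex_Analysis.Complex_Analysis"
begin

definition upper_half_plane :: "complex set" where
  "upper_half_plane = {z. Im z > 0}"

definition e2pi :: "complex \<Rightarrow> complex" where
  "e2pi z = exp (2 * of_real pi * \<i> * z)"

text \<open>Functions on the upper half-plane are total functions on \<^typ>\<open>complex\<close>; every condition
  below constrains them on \<^const>\<open>upper_half_plane\<close> only.\<close>

definition modular_of_weight :: "int \<Rightarrow> (complex \<Rightarrow> complex) \<Rightarrow> bool" where
  "modular_of_weight \<kappa> f \<longleftrightarrow>
     (\<forall>a b c d :: int. a * d - b * c = 1 \<longrightarrow>
        (\<forall>z\<in>upper_half_plane.
           f ((of_int a * z + of_int b) / (of_int c * z + of_int d)) =
             (of_int c * z + of_int d) powi \<kappa> * f z))"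

text \<open>The \<open>n\<close>-th Hecke operator in weight \<open>\<kappa>\<close>, normalised so that its eigenvalue on a form with
  \<open>\<A>\<^sub>f(1) = 1\<close> is \<open>\<A>\<^sub>f(n)\<close>:
  \<open>T\<^sub>n f(z) = n\<^bsup>(\<kappa>-1)/2\<^esup> \<Sum>\<^bsub>ad = n\<^esub> d\<^bsup>-\<kappa>\<^esup> \<Sum>\<^bsub>0 \<le> b < d\<^esub> f((az + b)/d)\<close>.
  Weight \<open>0\<close> is the case of Maass forms, with the usual factor \<open>n\<^bsup>-1/2\<^esup>\<close>.\<close>

definition hecke_operator :: "int \<Rightarrow> nat \<Rightarrow> (complex \<Rightarrow> complex) \<Rightarrow> complex \<Rightarrow> complex" where
  "hecke_operator \<kappa> n f z =
     of_real (real n powr ((real_of_int \<kappa> - 1) / 2)) *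
     (\<Sum>d | d dvd n. of_nat d powi (-\<kappa>) *
        (\<Sum>b<d. f ((of_nat (n div d) * z + of_nat b) / of_nat d)))"

definition hecke_eigenform :: "int \<Rightarrow> (complex \<Rightarrow> complex) \<Rightarrow> bool" where
  "hecke_eigenform \<kappa> f \<longleftrightarrow>
     (\<forall>n\<ge>1. \<exists>l. \<forall>z\<in>upper_half_plane. hecke_operator \<kappa> n f z = l * f z)"

definition holomorphic_cusp_form :: "int \<Rightarrow> (complex \<Rightarrow> complex) \<Rightarrow> bool" where
  "holomorphic_cusp_form \<kappa> f \<longleftrightarrow>
     f holomorphic_on upper_half_plane \<and>
     modular_of_weight \<kappa> f \<and>
     (f \<longlongrightarrow> 0) (filtercomap Im at_top)"

definition partial_x :: "(complex \<Rightarrow> complex) \<Rightarrow> complex \<Rightarrow> complex" where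
  "partial_x f z = vector_derivative (\<lambda>t::real. f (z + of_real t)) (at 0)"

definition partial_y :: "(complex \<Rightarrow> complex) \<Rightarrow> complex \<Rightarrow> complex" where
  "partial_y f z = vector_derivative (\<lambda>t::real. f (z + \<i> * of_real t)) (at 0)"

text \<open>\<open>C\<^sup>k\<close> in the real sense on an open set: all iterated partial derivatives up to order \<open>k\<close>
  exist, and those of order \<open>k\<close> are continuous.\<close>

primrec real_Ck_on :: "nat \<Rightarrow> (complex \<Rightarrow> complex) \<Rightarrow> complex set \<Rightarrow> bool" where
  "real_Ck_on 0 f U \<longleftrightarrow> continuous_on U f"
| "real_Ck_on (Suc k) f U \<longleftrightarrow>
     (\<forall>z\<in>U. (\<lambda>t::real. f (z + of_real t)) differentiable (at 0) \<and>
            (\<lambda>t::real. f (z + \<i> * of_real t)) differentiable (at 0)) \<and>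
     real_Ck_on k (partial_x f) U \<and> real_Ck_on k (partial_y f) U"

definition real_smooth_on :: "(complex \<Rightarrow> complex) \<Rightarrow> complex set \<Rightarrow> bool" where
  "real_smooth_on f U \<longleftrightarrow> (\<forall>k. real_Ck_on k f U)"

definition hyperbolic_laplacian :: "(complex \<Rightarrow> complex) \<Rightarrow> complex \<Rightarrow> complex" where
  "hyperbolic_laplacian f z =
     - of_real ((Im z)\<^sup>2) * (partial_x (partial_x f) z + partial_y (partial_y f) z)"

text \<open>A Maass cusp form for the full modular group with Laplace eigenvalue \<open>1/4 + \<nu>\<^sup>2\<close>.  The
  parameter is complex so that no a priori bound on the eigenvalue is built in.\<close>

definition maass_cusp_form :: "complex \<Rightarrow> (complex \<Rightarrow> complex) \<Rightarrow> bool" where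
  "maass_cusp_form \<nu> f \<longleftrightarrow>
     real_smooth_on f upper_half_plane \<and>
     modular_of_weight 0 f \<and>
     (\<forall>z\<in>upper_half_plane. hyperbolic_laplacian f z = (1 / 4 + \<nu>\<^sup>2) * f z) \<and>
     (\<exists>(C::real) (N::nat). \<forall>x y. y \<ge> 1 \<longrightarrow> cmod (f (Complex x y)) \<le> C * y ^ N) \<and>
     (\<forall>y>0. integral {0..1} (\<lambda>x. f (Complex x y)) = 0)"

text \<open>\<open>K\<^sub>s(y) = \<integral>\<^sub>0\<^sup>\<infinity> exp(-y cosh t) cosh(st) dt\<close> for \<open>y > 0\<close>.\<close>

definition bessel_K :: "complex \<Rightarrow> real \<Rightarrow> complex" where
  "bessel_K s y = integral {0..} (\<lambda>t::real. of_real (exp (- y * cosh t)) * cosh (s * of_real t))"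

text \<open>In both cases below the coefficients are indexed by the integers; in the holomorphic case only
  those at positive integers are constrained.\<close>

definition holomorphic_normalized_coeffs ::
    "int \<Rightarrow> (complex \<Rightarrow> complex) \<Rightarrow> (int \<Rightarrow> complex) \<Rightarrow> bool" where
  "holomorphic_normalized_coeffs \<kappa> f A \<longleftrightarrow>
     (\<forall>z\<in>upper_half_plane.
        ((\<lambda>n. A n * of_real (real_of_int n powr ((real_of_int \<kappa> - 1) / 2)) * e2pi (of_int n * z))
           has_sum f z) {1..}) \<and>
     A 1 = 1"

definition maass_normalized_coeffs ::
    "complex \<Rightarrow> (complex \<Rightarrow> complex) \<Rightarrow> (int \<Rightarrow> complex) \<Rightarrow> bool" where
  "maass_normalized_coeffs \<nu> f A \<longleftrightarrow>
     (\<forall>x y. y > 0 \<longrightarrow>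
        ((\<lambda>n. 2 * of_real (sqrt y) * A n * bessel_K (\<i> * \<nu>) (2 * pi * \<bar>real_of_int n\<bar> * y) *
              e2pi (of_int n * of_real x))
           has_sum f (Complex x y)) {n. n \<noteq> 0}) \<and>
     A 1 = 1"

end

theory Submission
  imports Defs
begin

text \<open>Form the matrix with entries \<open>A (n + m)\<close>, for \<open>n \<le> X\<close> and \<open>m \<le> Y\<close>.  It is a Hankel matrix, so its
operator norm is at most the supremum over \<open>x\<close> of the exponential sum \<open>\<Sum>k \<le> N. A k * e(k * x)\<close> with
\<open>N\<close> about \<open>X + Y\<close> (\<open>hankel_form_bound\<close>).  Wilton's classical estimate says that this sum is
\<open>O(sqrt N * ln N)\<close> uniformly in \<open>x\<close>.  Since \<open>Y < X\<close>, the bilinear form is \<open>O(sqrt X * ln X)\<close> times the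
two Euclidean norms.  The bound to be proved is about \<open>X powr (7 / 8) * Y powr (- 1 / 4)\<close> times the
norms, and this is at least \<open>X powr (5 / 8)\<close>.

Wilton's estimate rests on the boundedness of \<open>cmod (f z) * Im z powr (\<kappa> / 2)\<close> on the upper half-plane
(with \<open>\<kappa> = 0\<close> for Maass forms).  The bound holds at height at least \<open>1 / 5\<close> by the Fourier expansion, and
every orbit of the modular group reaches that height (\<open>modular_form_bounded\<close>).  Along the line of
height \<open>y\<close> the expansion of \<open>f\<close> has coefficients \<open>A n * w (\<bar>n\<bar> * y)\<close>, up to a power of \<open>y\<close>, where
\<open>w\<close> is a power times an exponential in the holomorphic case and a K-Bessel function in the Maass case.
Cutting off the frequencies above \<open>N\<close> costs a logarithm, the \<open>L\<^sup>1\<close> norm of the Dirichlet kernel.  The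
weight \<open>w\<close> is then removed by partial summation on dyadic blocks, with \<open>y\<close> inversely proportional to the
length of the block (\<open>wilton_bound\<close>).  For Maass forms this needs information on the Bessel function:
exponential upper and lower bounds for large argument, and a Lipschitz estimate.\<close>

section \<open>Bilinear forms with a coefficient depending on n + m\<close>

lemma cis_two_pi_eq_1_iff: "cis (2 * pi * x) = 1 \<longleftrightarrow> x \<in> \<int>"
proof -
  have "cis (2 * pi * x) = 1 \<longleftrightarrow> (\<exists>n::int. x = of_int n)"
    by (auto simp: cis_conv_exp exp_eq_1)
  then show ?thesis
    by (auto simp: Ints_def)
qed

lemma sum_cis_root_of_unity:
  fixes k :: int
  assumes "R > 0"
  shows "(\<Sum>j<R. cis (2 * pi * (of_int k * real j / real R))) =
           (if int R dvd k then of_nat R else 0)"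
proof -
  define z where "z = cis (2 * pi * (of_int k / real R))"
  have pw: "cis (2 * pi * (of_int k * real j / real R)) = z ^ j" for j
    unfolding z_def Complex.DeMoivre by (rule arg_cong[of _ _ cis]) simp
  have "z ^ R = cis (2 * pi * of_int k)"
    unfolding z_def Complex.DeMoivre by (rule arg_cong[of _ _ cis]) (use assms in simp)
  then have zR: "z ^ R = 1" by simp
  have "z = 1 \<longleftrightarrow> int R dvd k"
  proof -
    have "z = 1 \<longleftrightarrow> (of_int k / real R) \<in> \<int>"
      unfolding z_def by (rule cis_two_pi_eq_1_iff)
    also have "\<dots> \<longleftrightarrow> int R dvd k"
      using assms of_int_div_of_int_in_Ints_iff[of k "int R", where 'a = real] by simp
    finally show ?thesis .
  qed
  then show ?thesis
    unfolding pw using zR assms by (auto simp: sum_gp_strict)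
qed

lemma dvd_iff_zero_if_abs_less:
  fixes d :: int
  assumes "\<bar>d\<bar> < int R"
  shows "int R dvd d \<longleftrightarrow> d = 0"
  using assms dvd_imp_le_int[of d "int R"] by auto

text \<open>Parseval's identity on the cyclic group of order \<open>R\<close>.  The condition \<open>P < R\<close> keeps the frequencies
\<open>1, \<dots>, P\<close> distinct modulo \<open>R\<close>, so that their characters are orthogonal.\<close>
lemma discrete_parseval:
  fixes a :: "nat \<Rightarrow> complex"
  assumes "P < R"
  shows "(\<Sum>j<R. (cmod (\<Sum>n=1..P. a n * cis (- (2 * pi * (real n * real j / real R)))))\<^sup>2) =
           real R * (\<Sum>n=1..P. (cmod (a n))\<^sup>2)"
proof -
  have R: "R > 0" using assms by simp
  have "of_real (\<Sum>j<R. (cmod (\<Sum>n=1..P. a n * cis (- (2 * pi * (real n * real j / real R)))))\<^sup>2) =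
        (\<Sum>j<R. \<Sum>n=1..P. \<Sum>m=1..P. a n * cnj (a m) *
            cis (2 * pi * (of_int (int m - int n) * real j / real R)))"
    unfolding of_real_sum complex_norm_square cnj_sum sum_product
    by (intro sum.cong refl)
       (simp add: cis_cnj cis_mult mult_ac flip: cis_mult, simp add: cis_mult algebra_simps diff_divide_distrib)
  also have "\<dots> = (\<Sum>n=1..P. \<Sum>m=1..P. a n * cnj (a m) *
            (\<Sum>j<R. cis (2 * pi * (of_int (int m - int n) * real j / real R))))"
    unfolding sum_distrib_left by (subst sum.swap, rule sum.cong[OF refl], rule sum.swap)
  also have "\<dots> = (\<Sum>n=1..P. \<Sum>m=1..P. if m = n then of_nat R * (a n * cnj (a n)) else 0)"
  proof (intro sum.cong refl)
    fix n m assume nm: "n \<in> {1..P}" "m \<in> {1..P}"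
    have "int R dvd (int m - int n) \<longleftrightarrow> m = n"
      using nm assms by (subst dvd_iff_zero_if_abs_less) auto
    then show "a n * cnj (a m) * (\<Sum>j<R. cis (2 * pi * (of_int (int m - int n) * real j / real R)))
        = (if m = n then of_nat R * (a n * cnj (a n)) else 0)"
      unfolding sum_cis_root_of_unity[OF R] by auto
  qed
  also have "\<dots> = of_real (real R * (\<Sum>n=1..P. (cmod (a n))\<^sup>2))"
    by (simp add: sum_distrib_left flip: complex_norm_square)
  finally show ?thesis
    by (simp only: of_real_eq_iff)
qed

text \<open>The matrix \<open>c (n + m)\<close> is a Hankel matrix, and its operator norm is at most the supremum norm of any
trigonometric polynomial whose coefficients are the \<open>c k\<close>: the form is the mean, over the circle, of
the product of the polynomials attached to \<open>a\<close>, \<open>b\<close> and \<open>c\<close>; the last one is bounded pointwise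
and the other two are treated by the Cauchy-Schwarz inequality and Parseval.  Averaging over the
\<open>R\<close>-th roots of unity instead of the circle keeps every sum finite.\<close>
lemma hankel_form_bound:
  fixes a b c :: "nat \<Rightarrow> complex"
  assumes B: "\<And>x. cmod (\<Sum>k=1..P+Q. c k * cis (2 * pi * (real k * x))) \<le> B"
  shows "cmod (\<Sum>n=1..P. \<Sum>m=1..Q. a n * b m * c (n + m)) \<le>
           B * L2_set (\<lambda>n. cmod (a n)) {1..P} * L2_set (\<lambda>m. cmod (b m)) {1..Q}"
proof -
  \<comment> \<open>Both \<open>k\<close> and \<open>n + m\<close> lie in \<open>{1..P + Q}\<close>, so with this modulus congruence forces equality.\<close>
  define R where "R = P + Q + 1"
  have R: "R > 0" "P < R" "Q < R" by (auto simp: R_def)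
  define w where "w = (\<lambda>k::nat. \<lambda>j::nat. cis (2 * pi * (real k * real j / real R)))"
  define w' where "w' = (\<lambda>k::nat. \<lambda>j::nat. cis (- (2 * pi * (real k * real j / real R))))"
  define fa where "fa = (\<lambda>j. \<Sum>n=1..P. a n * w' n j)"
  define fb where "fb = (\<lambda>j. \<Sum>m=1..Q. b m * w' m j)"
  define fc where "fc = (\<lambda>j. \<Sum>k=1..P+Q. c k * w k j)"
  have pick: "c (n + m) * of_nat R = (\<Sum>k=1..P+Q. c k * (\<Sum>j<R. w k j * w' n j * w' m j))"
    if "n \<in> {1..P}" "m \<in> {1..Q}" for n m
  proof -
    have prod_eq: "w k j * w' n j * w' m j = cis (2 * pi * (of_int (int k - int n - int m) * real j / real R))"
      for k j
      unfolding w_def w'_def by (simp add: cis_mult algebra_simps diff_divide_distrib add_divide_distrib)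
    have "(\<Sum>j<R. w k j * w' n j * w' m j) = (if k = n + m then of_nat R else 0)"
      if k: "k \<in> {1..P+Q}" for k
    proof -
      have "int R dvd (int k - int n - int m) \<longleftrightarrow> k = n + m"
        using k \<open>n \<in> {1..P}\<close> \<open>m \<in> {1..Q}\<close>
        by (subst dvd_iff_zero_if_abs_less) (auto simp: R_def)
      then show ?thesis
        unfolding prod_eq sum_cis_root_of_unity[OF R(1)] by simp
    qed
    then have "(\<Sum>k=1..P+Q. c k * (\<Sum>j<R. w k j * w' n j * w' m j)) =
        (\<Sum>k=1..P+Q. if k = n + m then c (n + m) * of_nat R else 0)"
      by (intro sum.cong) auto
    then show ?thesis using that by simp
  qed
  have "(\<Sum>n=1..P. \<Sum>m=1..Q. a n * b m * c (n + m)) * of_nat R =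
        (\<Sum>n=1..P. \<Sum>m=1..Q. a n * b m * (\<Sum>k=1..P+Q. c k * (\<Sum>j<R. w k j * w' n j * w' m j)))"
    unfolding sum_distrib_right using pick by (intro sum.cong) (auto simp: mult.assoc)
  also have "\<dots> = (\<Sum>n=1..P. \<Sum>m=1..Q. \<Sum>k=1..P+Q. \<Sum>j<R. (a n * w' n j) * (b m * w' m j) * (c k * w k j))"
    by (simp add: sum_distrib_left mult_ac)
  also have "\<dots> = (\<Sum>n=1..P. \<Sum>m=1..Q. \<Sum>j<R. \<Sum>k=1..P+Q. (a n * w' n j) * (b m * w' m j) * (c k * w k j))"
    by (intro sum.cong refl sum.swap)
  also have "\<dots> = (\<Sum>n=1..P. \<Sum>j<R. \<Sum>m=1..Q. \<Sum>k=1..P+Q. (a n * w' n j) * (b m * w' m j) * (c k * w k j))"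
    by (intro sum.cong refl sum.swap)
  also have "\<dots> = (\<Sum>j<R. \<Sum>n=1..P. \<Sum>m=1..Q. \<Sum>k=1..P+Q. (a n * w' n j) * (b m * w' m j) * (c k * w k j))"
    by (rule sum.swap)
  also have "\<dots> = (\<Sum>j<R. fa j * fb j * fc j)"
    unfolding fa_def fb_def fc_def
    by (simp only: sum_distrib_left[symmetric] sum_distrib_right[symmetric])
  finally have eq: "(\<Sum>n=1..P. \<Sum>m=1..Q. a n * b m * c (n + m)) * of_nat R = (\<Sum>j<R. fa j * fb j * fc j)" .
  have B0: "B \<ge> 0" using B[of 0] norm_ge_zero order_trans by blast
  have fc: "cmod (fc j) \<le> B" for j
    using B[of "real j / real R"] by (simp add: fc_def w_def)
  have L2: "L2_set (\<lambda>j. cmod (fa j)) {..<R} = sqrt (real R) * L2_set (\<lambda>n. cmod (a n)) {1..P}"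
           "L2_set (\<lambda>j. cmod (fb j)) {..<R} = sqrt (real R) * L2_set (\<lambda>m. cmod (b m)) {1..Q}"
    unfolding fa_def fb_def w'_def L2_set_def
    using discrete_parseval[OF R(2), of a] discrete_parseval[OF R(3), of b]
    by (simp_all add: real_sqrt_mult)
  have "cmod (\<Sum>j<R. fa j * fb j * fc j) \<le> (\<Sum>j<R. \<bar>cmod (fa j)\<bar> * \<bar>cmod (fb j)\<bar> * B)"
    by (rule sum_norm_le) (auto simp: norm_mult intro!: mult_left_mono fc)
  also have "\<dots> \<le> L2_set (\<lambda>j. cmod (fa j)) {..<R} * L2_set (\<lambda>j. cmod (fb j)) {..<R} * B"
    unfolding sum_distrib_right[symmetric] by (intro mult_right_mono L2_set_mult_ineq B0)
  also have "\<dots> = real R * (B * L2_set (\<lambda>n. cmod (a n)) {1..P} * L2_set (\<lambda>m. cmod (b m)) {1..Q})"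
    unfolding L2 by (simp add: mult_ac)
  finally have "cmod (\<Sum>n=1..P. \<Sum>m=1..Q. a n * b m * c (n + m)) * real R \<le>
     real R * (B * L2_set (\<lambda>n. cmod (a n)) {1..P} * L2_set (\<lambda>m. cmod (b m)) {1..Q})"
    by (simp only: eq[symmetric] norm_mult norm_of_nat)
  then show ?thesis using R(1) by (simp add: mult.commute)
qed

section \<open>The Dirichlet kernel\<close>

lemma jordan_inequality:
  assumes "0 \<le> t" "t \<le> 1 / 2"
  shows "2 * t \<le> sin (pi * t)"
proof -
  have "concave_on {0..pi/2} sin"
    by (rule f''_le0_imp_concave[where f' = cos and f'' = "\<lambda>x. - sin x"])
       (auto intro!: derivative_eq_intros sin_ge_zero)
  from concave_onD[OF this, of "2 * t" 0 "pi / 2"] assms show ?thesis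
    by (simp add: mult.commute)
qed

definition dirichlet_kernel :: "nat \<Rightarrow> real \<Rightarrow> complex" where
  "dirichlet_kernel N t = (\<Sum>k=1..N. cis (- (2 * pi * (real k * t))))"

text \<open>Up to a constant this is the usual bound by the minimum of \<open>N\<close> and the reciprocal distance of \<open>t\<close>
to the integers, here written as a sum of two smooth functions.  In this form the majorant is continuous on \<open>[0, 1]\<close> and has an
elementary primitive.\<close>
lemma dirichlet_kernel_bound:
  assumes "N \<ge> 1" "0 \<le> t" "t \<le> 1"
  shows "cmod (dirichlet_kernel N t) \<le>
           2 / (1 / real N + 2 * t) + 2 / (1 / real N + 2 * (1 - t))"
proof -
  define D where "D = cmod (dirichlet_kernel N t)"
  define z where "z = cis (- (2 * pi * t))"
  have DN: "D \<le> real N"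
    unfolding D_def dirichlet_kernel_def
    by (rule order_trans[OF norm_sum]) simp
  have D_eq: "dirichlet_kernel N t = (\<Sum>k=1..N. z ^ k)"
    unfolding dirichlet_kernel_def z_def by (intro sum.cong) (auto simp: Complex.DeMoivre algebra_simps)
  have "(1 - z) * dirichlet_kernel N t = z - z ^ Suc N"
    unfolding D_eq using sum_gp_multiplied[of 1 N z] assms by simp
  moreover have "cmod (z - z ^ Suc N) \<le> 2"
    using norm_triangle_ineq4[of z "z ^ Suc N"] by (simp add: norm_mult norm_power z_def)
  moreover have "cmod (1 - z) = 2 * sin (pi * t)"
  proof -
    have "(cmod (1 - z))\<^sup>2 = (1 - cos (2 * (pi * t)))\<^sup>2 + (sin (2 * (pi * t)))\<^sup>2"
      by (simp add: z_def cmod_power2 mult_ac)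
    also have "\<dots> = 2 - 2 * cos (2 * (pi * t))"
      using sin_cos_squared_add[of "2 * (pi * t)"] by (simp add: power2_eq_square algebra_simps)
    also have "\<dots> = (2 * sin (pi * t))\<^sup>2"
      unfolding cos_double_sin by (simp add: power2_eq_square)
    finally show ?thesis
      using assms by (intro power2_eq_imp_eq[of "cmod (1 - z)"]) (auto intro!: sin_ge_zero)
  qed
  ultimately have "2 * sin (pi * t) * D \<le> 2"
    by (metis D_def norm_mult)
  then have DS: "D * sin (pi * t) \<le> 1"
    by (simp add: mult_ac)
  \<comment> \<open>\<open>u\<close> stands for the distance of \<open>t\<close> to the nearest integer; \<open>sin (pi * t)\<close> does not see the difference.\<close>
  have DS': "D * (2 * u) \<le> 1" if "0 \<le> u" "u \<le> 1/2" "u = t \<or> u = 1 - t" for u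
  proof -
    have "sin (pi * u) = sin (pi * t)"
      using that(3) by (auto simp: right_diff_distrib sin_diff)
    then have "D * (2 * u) \<le> D * sin (pi * t)"
      using jordan_inequality[OF that(1,2)] by (intro mult_left_mono) (auto simp: D_def)
    with DS show ?thesis by simp
  qed
  have key: "D \<le> 2 / (1 / real N + 2 * u)" if "0 \<le> u" "u \<le> 1/2" "u = t \<or> u = 1 - t" for u
  proof -
    have "D * (1 / real N) \<le> 1" using DN assms by (simp add: field_simps)
    with DS'[OF that] have "D * (1 / real N + 2 * u) \<le> 2" by (simp add: algebra_simps)
    then show ?thesis using that assms by (simp add: pos_le_divide_eq add_pos_nonneg)
  qed
  have "0 \<le> 2 / (1 / real N + 2 * t)" "0 \<le> 2 / (1 / real N + 2 * (1 - t))"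
    using assms by auto
  then show ?thesis
    using key[of t] key[of "1 - t"] assms unfolding D_def[symmetric] by linarith
qed

lemma has_integral_dirichlet_majorant:
  assumes "N \<ge> 1"
  shows "((\<lambda>t. 2 / (1 / real N + 2 * t) + 2 / (1 / real N + 2 * (1 - t)))
            has_integral 2 * ln (1 + 2 * real N)) {0..1}"
proof -
  define d where "d = 1 / real N"
  have d: "d > 0" using assms by (simp add: d_def)
  define F where "F = (\<lambda>t. ln (d + 2 * t) - ln (d + 2 * (1 - t)))"
  have "((\<lambda>t. 2 / (d + 2 * t) + 2 / (d + 2 * (1 - t))) has_integral F 1 - F 0) {0..1}"
    unfolding F_def using d
    by (intro fundamental_theorem_of_calculus)
       (auto intro!: derivative_eq_intros simp flip: has_real_derivative_iff_has_vector_derivative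
             simp: add_pos_nonneg)
  moreover have "F 1 - F 0 = 2 * ln (1 + 2 * real N)"
  proof -
    have "F 1 - F 0 = 2 * (ln (d + 2) - ln d)" by (simp add: F_def)
    also have "ln (d + 2) - ln d = ln ((d + 2) / d)" using d by (simp add: ln_div)
    also have "(d + 2) / d = 1 + 2 * real N" using assms by (simp add: d_def field_simps)
    finally show ?thesis .
  qed
  ultimately show ?thesis by (simp add: d_def)
qed

section \<open>Partial sums of Fourier series and Wilton's bound\<close>

lemma has_integral_cis_period:
  fixes m :: int
  shows "((\<lambda>t. cis (2 * pi * (of_int m * t))) has_integral (if m = 0 then 1 else 0)) {0..1}"
proof (cases "m = 0")
  case True
  then show ?thesis using has_integral_const_real[of "1::complex" 0 1] by simp
next
  case False
  define c :: complex where "c = 2 * of_real pi * \<i> * of_int m"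
  have c: "c \<noteq> 0" using False by (simp add: c_def)
  have cis: "cis (2 * pi * (of_int m * t)) = exp (c * of_real t)" for t
    by (simp add: cis_conv_exp c_def mult_ac)
  have "((\<lambda>t. exp (c * of_real t)) has_integral exp (c * of_real 1) / c - exp (c * of_real 0) / c) {0..1}"
    using c
    by (intro fundamental_theorem_of_calculus has_vector_derivative_real_field)
       (auto intro!: derivative_eq_intros)
  moreover have "exp (c * of_real 1) = 1"
    using cis[of 1] by (simp flip: cis)
  ultimately show ?thesis using False by (simp add: cis)
qed

text \<open>The series converges at \<open>x = 0\<close>, hence absolutely, hence uniformly in \<open>x\<close>; this justifies integrating
it term by term.\<close>
lemma fourier_coefficient_integral:
  fixes g :: "int \<Rightarrow> complex"
  assumes has: "\<And>x. ((\<lambda>n. g n * cis (2 * pi * (of_int n * x))) has_sum G x) S"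
    and k: "k \<in> S"
  shows "((\<lambda>t. G (x + t) * cis (- (2 * pi * (of_int k * t)))) has_integral
            g k * cis (2 * pi * (of_int k * x))) {0..1}"
proof -
  define h where "h = (\<lambda>n t. g n * cis (2 * pi * (of_int n * (x + t))) * cis (- (2 * pi * (of_int k * t))))"
  have h_alt: "h n t = g n * cis (2 * pi * (of_int n * x)) * cis (2 * pi * (of_int (n - k) * t))" for n t
    unfolding h_def by (simp add: mult.assoc cis_mult algebra_simps)
  have "g summable_on S"
    using has_sum_imp_summable[OF has[of 0]] by simp
  then have "(\<lambda>n. norm (g n)) summable_on S"
    using summable_on_iff_abs_summable_on_complex by blast
  then have "uniform_limit {0..1} (\<lambda>F t. \<Sum>n\<in>F. h n t)
      (\<lambda>t. G (x + t) * cis (- (2 * pi * (of_int k * t)))) (finite_subsets_at_top S)"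
    unfolding h_def
    by (intro Weierstrass_m_test_general' has_sum_cmult_left has) (auto simp: norm_mult)
  moreover have "continuous_on {0..1} (\<lambda>t. \<Sum>n\<in>F. h n t)" for F
    unfolding h_alt by (intro continuous_intros)
  ultimately obtain I J where I: "\<And>F. ((\<lambda>t. \<Sum>n\<in>F. h n t) has_integral I F) {0..1}"
    and J: "((\<lambda>t. G (x + t) * cis (- (2 * pi * (of_int k * t)))) has_integral J) {0..1}"
    and lim: "(I \<longlongrightarrow> J) (finite_subsets_at_top S)"
    by (rule uniform_limit_integral) auto
  have "\<forall>\<^sub>F F in finite_subsets_at_top S. I F = g k * cis (2 * pi * (of_int k * x))"
  proof (rule eventually_mono)
    show "\<forall>\<^sub>F F in finite_subsets_at_top S. finite F \<and> {k} \<subseteq> F \<and> F \<subseteq> S"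
      unfolding eventually_finite_subsets_at_top
      by (rule exI[of _ "{k}"]) (use k in auto)
  next
    fix F assume F: "finite F \<and> {k} \<subseteq> F \<and> F \<subseteq> S"
    have "((\<lambda>t. \<Sum>n\<in>F. h n t) has_integral
        (\<Sum>n\<in>F. g n * cis (2 * pi * (of_int n * x)) * (if n - k = 0 then 1 else 0))) {0..1}"
      unfolding h_alt using F
      by (intro has_integral_sum has_integral_mult_right has_integral_cis_period) auto
    then have "I F = (\<Sum>n\<in>F. g n * cis (2 * pi * (of_int n * x)) * (if n - k = 0 then 1 else 0))"
      using I has_integral_unique by blast
    also have "\<dots> = (\<Sum>n\<in>F. if n = k then g k * cis (2 * pi * (of_int k * x)) else 0)"
      by (intro sum.cong) auto
    also have "\<dots> = g k * cis (2 * pi * (of_int k * x))"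
      using F by simp
    finally show "I F = g k * cis (2 * pi * (of_int k * x))" .
  qed
  then have "(I \<longlongrightarrow> g k * cis (2 * pi * (of_int k * x))) (finite_subsets_at_top S)"
    by (rule tendsto_eventually)
  with lim have "J = g k * cis (2 * pi * (of_int k * x))"
    by (intro tendsto_unique[of "finite_subsets_at_top S"]) auto
  with J show ?thesis by simp
qed

text \<open>Cutting a Fourier series down to the frequencies \<open>1, \<dots>, N\<close> is convolution with the Dirichlet kernel,
whose \<open>L\<^sup>1\<close> norm is logarithmic.  The frequency set \<open>S\<close> is left open because a holomorphic form has
only positive frequencies and a Maass form has all nonzero ones.\<close>
lemma partial_sum_le_sup_times_log:
  fixes g :: "int \<Rightarrow> complex"
  assumes has: "\<And>x. ((\<lambda>n. g n * cis (2 * pi * (of_int n * x))) has_sum G x) S"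
    and S: "{1..} \<subseteq> S"
    and B: "\<And>x. cmod (G x) \<le> B"
  shows "cmod (\<Sum>k=1..N. g (int k) * cis (2 * pi * (real k * x))) \<le> B * (2 * ln (1 + 2 * real N))"
proof (cases "N \<ge> 1")
  case True
  define maj where "maj = (\<lambda>t. 2 / (1 / real N + 2 * t) + 2 / (1 / real N + 2 * (1 - t)))"
  have maj: "((\<lambda>t. B * maj t) has_integral B * (2 * ln (1 + 2 * real N))) {0..1}"
    unfolding maj_def by (intro has_integral_mult_right has_integral_dirichlet_majorant True)
  have "((\<lambda>t. \<Sum>k=1..N. G (x + t) * cis (- (2 * pi * (of_int (int k) * t)))) has_integral
          (\<Sum>k=1..N. g (int k) * cis (2 * pi * (of_int (int k) * x)))) {0..1}"
    using S by (intro has_integral_sum fourier_coefficient_integral[OF has]) auto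
  then have int: "((\<lambda>t. G (x + t) * dirichlet_kernel N t) has_integral
          (\<Sum>k=1..N. g (int k) * cis (2 * pi * (real k * x)))) {0..1}"
    by (simp add: dirichlet_kernel_def sum_distrib_left)
  have B0: "B \<ge> 0" using B[of 0] norm_ge_zero order_trans by blast
  have "cmod (G (x + t) * dirichlet_kernel N t) \<le> B * maj t" if "t \<in> {0..1}" for t
    unfolding norm_mult maj_def using dirichlet_kernel_bound[OF True, of t] that B B0
    by (intro mult_mono) auto
  then have "cmod (integral {0..1} (\<lambda>t. G (x + t) * dirichlet_kernel N t)) \<le>
      integral {0..1} (\<lambda>t. B * maj t)"
    using int maj by (intro integral_norm_bound_integral) (auto simp: integrable_on_def)
  then show ?thesis
    unfolding integral_unique[OF int] integral_unique[OF maj] .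
next
  case False
  then have "N = 0" by simp
  then show ?thesis by simp
qed

lemma abel_summation_bound:
  fixes c v :: "nat \<Rightarrow> complex"
  assumes MN: "1 \<le> M" "M \<le> N"
    and T: "\<And>k. k \<le> N \<Longrightarrow> cmod (\<Sum>j=1..k. c j) \<le> T"
    and V: "\<And>k. M \<le> k \<Longrightarrow> k \<le> N \<Longrightarrow> cmod (v k) \<le> V"
    and D: "\<And>k. M \<le> k \<Longrightarrow> k < N \<Longrightarrow> cmod (v (Suc k) - v k) \<le> D"
  shows "cmod (\<Sum>k=M..N. c k * v k) \<le> T * (2 * V + real (N - M) * D)"
proof -
  define P where "P = (\<lambda>k. \<Sum>j=1..k. c j)"
  have "(\<Sum>k=M..N. c k * v k) = P N * v N - P (M - 1) * v M - (\<Sum>k=M..<N. P k * (v (Suc k) - v k))"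
    using MN(2)
  proof (induction N rule: dec_induct)
    case base
    obtain m where "M = Suc m" using MN(1) by (cases M) auto
    then show ?case by (simp add: P_def algebra_simps)
  next
    case (step n)
    then show ?case by (simp add: P_def algebra_simps)
  qed
  also have "cmod \<dots> \<le> cmod (P N * v N) + cmod (P (M - 1) * v M) +
      cmod (\<Sum>k=M..<N. P k * (v (Suc k) - v k))"
    by (meson norm_triangle_ineq4 add_right_mono order_trans)
  also have "\<dots> \<le> T * V + T * V + (\<Sum>k=M..<N. T * D)"
  proof -
    have T0: "T \<ge> 0" using T[of 0] by simp
    show ?thesis
      using MN T0 unfolding norm_mult P_def
      by (intro add_mono mult_mono T V sum_norm_le) (auto simp: norm_mult intro!: mult_mono T[simplified] D)
  qed
  also have "\<dots> = T * (2 * V + real (N - M) * D)"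
    by (simp add: algebra_simps)
  finally show ?thesis .
qed

text \<open>Wilton's argument, for holomorphic and Maass forms at once.  Both have an expansion along horizontal
lines with coefficients \<open>A n * w (\<bar>n\<bar> * y)\<close> for a fixed profile \<open>w\<close>, and the sum is \<open>O(1 / sqrt y)\<close>
uniformly in \<open>x\<close>.  On a dyadic block \<open>M \<le> n \<le> 2 * M\<close> the height \<open>y = u0 / M\<close> puts all arguments of
\<open>w\<close> into \<open>[u0, 2 * u0]\<close>.  There \<open>1 / w\<close> is bounded and Lipschitz, so the profile can be removed by
summation by parts, at the cost of a constant.  The block then contributes \<open>O(sqrt M * ln M)\<close>, and
these contributions form a geometric series.  Only one interval \<open>[u0, 2 * u0]\<close> without zeros of \<open>w\<close> is
required, which matters for the Bessel function: it may vanish at small arguments.\<close>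
lemma wilton_bound:
  fixes A :: "int \<Rightarrow> complex" and w :: "real \<Rightarrow> complex" and G :: "real \<Rightarrow> real \<Rightarrow> complex"
  assumes has: "\<And>x y. y > 0 \<Longrightarrow>
      ((\<lambda>n. A n * w (\<bar>of_int n\<bar> * y) * cis (2 * pi * (of_int n * x))) has_sum G x y) S"
    and S: "{1..} \<subseteq> S"
    and bound: "\<And>x y. y > 0 \<Longrightarrow> cmod (G x y) \<le> B / sqrt y"
    and u0: "u0 > 0"
    and m: "m > 0"
    and lower: "\<And>u. u0 \<le> u \<Longrightarrow> u \<le> 2 * u0 \<Longrightarrow> m \<le> cmod (w u)"
    and lip: "\<And>u u'. u0 \<le> u \<Longrightarrow> u \<le> u' \<Longrightarrow> u' \<le> 2 * u0 \<Longrightarrow> cmod (w u' - w u) \<le> L' * (u' - u)"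
  shows "\<exists>C>0. \<forall>N x. cmod (\<Sum>k=1..N. A (int k) * cis (2 * pi * (real k * x))) \<le>
           C * sqrt (real N) * ln (1 + 2 * real N)"
proof -
  define v where "v = (\<lambda>u. 1 / w u)"
  define V where "V = 1 / m"
  define L where "L = L' / m\<^sup>2"
  have inv: "w u * v u = 1" and V: "cmod (v u) \<le> V" if "u0 \<le> u" "u \<le> 2 * u0" for u
    using lower[OF that] m by (auto simp: v_def V_def norm_divide frac_le)
  have L: "cmod (v u' - v u) \<le> L * (u' - u)" if "u0 \<le> u" "u \<le> u'" "u' \<le> 2 * u0" for u u'
  proof -
    have w: "m \<le> cmod (w u)" "m \<le> cmod (w u')" using that by (auto intro: lower)
    have "w u \<noteq> 0" "w u' \<noteq> 0" using w m by force+
    then have "v u' - v u = - (w u' - w u) / (w u * w u')"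
      by (simp add: v_def field_simps)
    then have "cmod (v u' - v u) = cmod (w u' - w u) / (cmod (w u) * cmod (w u'))"
      by (simp add: norm_divide norm_mult norm_minus_commute)
    also have "\<dots> \<le> L' * (u' - u) / (m * m)"
      using w m by (intro frac_le lip that mult_mono) (auto intro: order_trans[OF norm_ge_zero lip] that)
    finally show ?thesis by (simp add: L_def power2_eq_square)
  qed
  define s where "s = (\<lambda>x k. A (int k) * cis (2 * pi * (real k * x)))"
  define C2 where "C2 = B / sqrt u0 * 2 * (2 * V + L * u0)"
  have B0: "B \<ge> 0" using order_trans[OF norm_ge_zero bound[of 1 0]] by simp
  have V0: "V \<ge> 0" using order_trans[OF norm_ge_zero V[of u0]] u0 by simp
  have L0: "L \<ge> 0"
    using order_trans[OF norm_ge_zero L[of u0 "2 * u0"]] u0 by (simp add: zero_le_mult_iff)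
  have C2: "C2 \<ge> 0" using B0 V0 L0 u0 by (simp add: C2_def)
  have block: "cmod (\<Sum>k=M..N. s x k) \<le> C2 * sqrt (real N) * ln (1 + 2 * real N)"
    if MN: "1 \<le> M" "M \<le> N" "N \<le> 2 * M" for M N x
  proof -
    define y where "y = u0 / real M"
    have y: "y > 0" using u0 MN by (simp add: y_def)
    define c where "c = (\<lambda>k. A (int k) * w (real k * y) * cis (2 * pi * (real k * x)))"
    have in_range: "u0 \<le> real k * y" "real k * y \<le> 2 * u0" if "M \<le> k" "k \<le> N" for k
    proof -
      have "real k \<le> real (2 * M)" using that MN by (simp only: of_nat_le_iff)
      then have "real M * u0 \<le> real k * u0" "real k * u0 \<le> real (2 * M) * u0"
        using u0 that by (simp_all only: mult_le_cancel_right_pos of_nat_le_iff)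
      then show "u0 \<le> real k * y" "real k * y \<le> 2 * u0"
        using MN by (simp_all add: y_def field_simps)
    qed
    have "(\<Sum>k=M..N. s x k) = (\<Sum>k=M..N. c k * v (real k * y))"
    proof (rule sum.cong)
      fix k assume k: "k \<in> {M..N}"
      have "c k * v (real k * y) = s x k * (w (real k * y) * v (real k * y))"
        by (simp add: c_def s_def mult_ac)
      also have "\<dots> = s x k"
        using inv[OF in_range] k by simp
      finally show "s x k = c k * v (real k * y)" ..
    qed simp
    also have "cmod \<dots> \<le> (B / sqrt y * (2 * ln (1 + 2 * real N))) * (2 * V + real (N - M) * (L * y))"
    proof (rule abel_summation_bound[OF MN(1,2)])
      fix k assume "k \<le> N"
      have "cmod (\<Sum>j=1..k. A (int j) * w (\<bar>of_int (int j)\<bar> * y) * cis (2 * pi * (real j * x))) \<le>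
          B / sqrt y * (2 * ln (1 + 2 * real k))"
        using partial_sum_le_sup_times_log[OF has[OF y] S bound[OF y]] .
      also have "\<dots> \<le> B / sqrt y * (2 * ln (1 + 2 * real N))"
        using \<open>k \<le> N\<close> B0 y by (intro mult_left_mono) auto
      finally show "cmod (\<Sum>j=1..k. c j) \<le> B / sqrt y * (2 * ln (1 + 2 * real N))"
        by (simp add: c_def)
    next
      fix k assume "M \<le> k" "k \<le> N"
      then show "cmod (v (real k * y)) \<le> V" by (intro V in_range)
    next
      fix k assume k: "M \<le> k" "k < N"
      have "cmod (v (real (Suc k) * y) - v (real k * y)) \<le> L * (real (Suc k) * y - real k * y)"
        using k y by (intro L in_range) auto
      then show "cmod (v (real (Suc k) * y) - v (real k * y)) \<le> L * y"
        by (simp add: algebra_simps)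
    qed
    also have "\<dots> \<le> (B / sqrt y * (2 * ln (1 + 2 * real N))) * (2 * V + L * u0)"
    proof (intro mult_left_mono add_left_mono)
      have "real (N - M) * (L * y) \<le> real M * (L * y)"
        using MN L0 y by (intro mult_right_mono) auto
      also have "\<dots> = L * u0" using MN by (simp add: y_def)
      finally show "real (N - M) * (L * y) \<le> L * u0" .
    qed (use B0 y in auto)
    also have "\<dots> = C2 * sqrt (real M) * ln (1 + 2 * real N)"
      using u0 MN by (simp add: C2_def y_def real_sqrt_divide field_simps)
    also have "\<dots> \<le> C2 * sqrt (real N) * ln (1 + 2 * real N)"
      using C2 MN by (intro mult_right_mono mult_left_mono) auto
    finally show ?thesis .
  qed
  \<comment> \<open>The upper half of \<open>{1..N}\<close> is one block and the lower half has length at most \<open>N / 2\<close>.  Since \<open>sqrt (1 / 2) \<le> 3 / 4\<close>, the constant reproduces itself: \<open>4 * C2 * (3 / 4) + C2 = 4 * C2\<close>.\<close>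
  have "cmod (\<Sum>k=1..N. s x k) \<le> (4 * C2 + 1) * sqrt (real N) * ln (1 + 2 * real N)" for N x
  proof (induction N rule: less_induct)
    case (less N)
    show ?case
    proof (cases "N = 0")
      case False
      define M where "M = (N + 1) div 2"
      have M: "1 \<le> M" "M \<le> N" "N \<le> 2 * M" "2 * (M - 1) \<le> N" "M - 1 < N"
        using False by (auto simp: M_def)
      have "sqrt (real (M - 1)) \<le> 3 / 4 * sqrt (real N)"
      proof (rule real_le_lsqrt)
        have "2 * real (M - 1) \<le> real N"
          using M(4) by (metis of_nat_le_iff of_nat_mult of_nat_numeral)
        then show "real (M - 1) \<le> (3 / 4 * sqrt (real N))\<^sup>2"
          by (simp add: power_mult_distrib power2_eq_square)
      qed simp
      then have "(4 * C2 + 1) * sqrt (real (M - 1)) * ln (1 + 2 * real (M - 1))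
          \<le> (4 * C2 + 1) * (3 / 4 * sqrt (real N)) * ln (1 + 2 * real N)"
        using C2 M by (intro mult_mono mult_left_mono) auto
      with less.IH[OF M(5)] have head: "cmod (\<Sum>k=1..M-1. s x k) \<le>
          (4 * C2 + 1) * (3 / 4 * sqrt (real N)) * ln (1 + 2 * real N)" by (rule order_trans)
      have split: "(\<Sum>k=1..N. s x k) = (\<Sum>k=1..M-1. s x k) + (\<Sum>k=M..N. s x k)"
        using sum.ub_add_nat[of 1 "M - 1" "s x" "N - (M - 1)"] M by simp
      have "cmod (\<Sum>k=1..N. s x k) \<le>
          (4 * C2 + 1) * (3 / 4 * sqrt (real N)) * ln (1 + 2 * real N) +
          C2 * sqrt (real N) * ln (1 + 2 * real N)"
        unfolding split
        by (rule order_trans[OF norm_triangle_ineq add_mono[OF head block[OF M(1,2,3)]]])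
      also have "\<dots> = (4 * C2 + 3 / 4) * (sqrt (real N) * ln (1 + 2 * real N))"
        by (simp add: algebra_simps)
      also have "\<dots> \<le> (4 * C2 + 1) * (sqrt (real N) * ln (1 + 2 * real N))"
        by (intro mult_right_mono) auto
      finally show ?thesis by (simp add: mult.assoc)
    qed auto
  qed
  then show ?thesis
    using C2 unfolding s_def by (intro exI[of _ "4 * C2 + 1"]) auto
qed

section \<open>The K-Bessel function\<close>

lemma cosh_ge_quarter_square:
  assumes "0 \<le> (t::real)"
  shows "t\<^sup>2 / 4 \<le> cosh t"
proof -
  have "t\<^sup>2 / 2 \<le> exp t"
    using exp_lower_Taylor_quadratic[OF assms] assms by simp
  then have "t\<^sup>2 / 4 \<le> exp t / 2" by simp
  also have "\<dots> \<le> cosh t" by (simp add: cosh_def)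
  finally show ?thesis .
qed

lemma norm_cosh_le: "cmod (cosh z) \<le> exp (cmod z)"
proof -
  have "cmod (cosh z) \<le> (cmod (exp z) + cmod (exp (- z))) / 2"
    unfolding cosh_def using norm_triangle_ineq[of "exp z" "exp (- z)"]
    by (simp add: norm_divide scaleR_conv_of_real norm_mult)
  also have "\<dots> \<le> (exp (cmod z) + exp (cmod z)) / 2"
  proof -
    have "cmod (exp z) \<le> exp (cmod z)" "cmod (exp (- z)) \<le> exp (cmod z)"
      using norm_exp[of z] norm_exp[of "- z"] by simp_all
    then show ?thesis by (intro divide_right_mono add_mono) auto
  qed
  finally show ?thesis by simp
qed

text \<open>The Bessel integral with absolute values inside.  All upper estimates for \<open>K\<^sub>s\<close> are expressed through
it, so its numerical size never has to be computed.\<close>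
definition bessel_K_majorant :: "complex \<Rightarrow> real \<Rightarrow> real" where
  "bessel_K_majorant s u = integral {0..} (\<lambda>t. exp (- u * cosh t) * cmod (cosh (s * of_real t)))"

text \<open>Since \<open>cosh t\<close> grows at least like \<open>t\<^sup>2 / 4\<close>, completing a square absorbs the factor \<open>exp (cmod s * t)\<close>
and one more factor \<open>exp t\<close>.  The resulting majorant is integrable.\<close>
lemma bessel_integrand_le_exp:
  assumes "u > 0" "t \<ge> 0"
  shows "exp (- u * cosh t) * cmod (cosh (s * of_real t)) \<le> exp ((cmod s + 1)\<^sup>2 / u) * exp (- 1 * t)"
proof -
  define a where "a = cmod s + 1"
  have "0 \<le> u * (t / 2 - a / u)\<^sup>2" using assms by simp
  also have "u * (t / 2 - a / u)\<^sup>2 = u * (t\<^sup>2 / 4) - a * t + a\<^sup>2 / u"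
    using assms by (simp add: power2_eq_square field_simps)
  finally have *: "a * t - u * (t\<^sup>2 / 4) \<le> a\<^sup>2 / u" by simp
  have "exp (- u * cosh t) * cmod (cosh (s * of_real t)) \<le> exp (- u * (t\<^sup>2 / 4)) * exp (cmod s * t)"
    using assms cosh_ge_quarter_square[of t] norm_cosh_le[of "s * of_real t"]
    by (intro mult_mono) (auto simp: norm_mult)
  also have "\<dots> = exp ((a * t - u * (t\<^sup>2 / 4)) - t)"
    by (simp add: a_def algebra_simps flip: exp_add)
  also have "\<dots> \<le> exp (a\<^sup>2 / u - t)" using * by simp
  also have "\<dots> = exp (a\<^sup>2 / u) * exp (- 1 * t)" by (simp flip: exp_add)
  finally show ?thesis by (simp add: a_def)
qed

lemma exp_bound_integrable:
  "u > 0 \<Longrightarrow> (\<lambda>t::real. exp ((cmod s + 1)\<^sup>2 / u) * exp (- 1 * t)) integrable_on {0..}"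
  using has_integral_exp_minus_to_infinity[of 1 0]
  by (intro integrable_on_mult_right) (auto simp: integrable_on_def)

lemma bessel_majorant_integrable:
  fixes s :: complex
  assumes "u > 0"
  shows "(\<lambda>t. exp (- u * cosh t) * cmod (cosh (s * of_real t))) integrable_on {0..}"
  using assms bessel_integrand_le_exp
  by (intro measurable_bounded_by_integrable_imp_integrable[OF _ exp_bound_integrable]
            continuous_imp_measurable_on_sets_lebesgue)
     (auto intro!: continuous_intros)

lemma bessel_integrable:
  fixes s :: complex
  assumes "u > 0"
  shows "(\<lambda>t. of_real (exp (- u * cosh t)) * cosh (s * of_real t)) integrable_on {0..}"
  using assms
  by (intro measurable_bounded_by_integrable_imp_integrable[OF _ bessel_majorant_integrable[of u s]]
            continuous_imp_measurable_on_sets_lebesgue)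
     (auto intro!: continuous_intros simp: norm_mult)

lemma bessel_K_majorant_nonneg: "bessel_K_majorant s u \<ge> 0"
proof (cases "(\<lambda>t. exp (- u * cosh t) * cmod (cosh (s * of_real t))) integrable_on {0..}")
  case True
  then show ?thesis unfolding bessel_K_majorant_def by (rule integral_nonneg) simp
qed (simp add: bessel_K_majorant_def not_integrable_integral)

text \<open>Because \<open>cosh t \<ge> 1\<close>, raising the argument from \<open>1\<close> to \<open>u\<close> gains at least \<open>exp (1 - u)\<close> at every
point of the integral.\<close>
lemma bessel_K_upper_bound:
  assumes "u \<ge> 1"
  shows "cmod (bessel_K s u) \<le> bessel_K_majorant s 1 * exp (1 - u)"
proof -
  have i1: "(\<lambda>t. of_real (exp (- u * cosh t)) * cosh (s * of_real t)) integrable_on {0..}"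
    using assms by (intro bessel_integrable) simp
  have i2: "(\<lambda>t. exp (- 1 * cosh t) * cmod (cosh (s * of_real t)) * exp (1 - u)) integrable_on {0..}"
    by (intro integrable_on_mult_left bessel_majorant_integrable) simp
  have "cmod (bessel_K s u) \<le>
      integral {0..} (\<lambda>t. exp (- 1 * cosh t) * cmod (cosh (s * of_real t)) * exp (1 - u))"
    unfolding bessel_K_def
  proof (rule integral_norm_bound_integral[OF i1 i2])
    fix t :: real assume "t \<in> {0..}"
    have "(u - 1) * 1 \<le> (u - 1) * cosh t"
      using assms cosh_real_ge_1 by (intro mult_left_mono) auto
    then have "exp (- u * cosh t) \<le> exp (- 1 * cosh t) * exp (1 - u)"
      by (simp add: algebra_simps flip: exp_add)
    then have "exp (- u * cosh t) * cmod (cosh (s * of_real t)) \<le>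
        exp (- 1 * cosh t) * exp (1 - u) * cmod (cosh (s * of_real t))"
      by (intro mult_right_mono) auto
    then show "norm (of_real (exp (- u * cosh t)) * cosh (s * of_real t)) \<le>
        exp (- 1 * cosh t) * cmod (cosh (s * of_real t)) * exp (1 - u)"
      by (simp add: norm_mult mult_ac)
  qed
  then show ?thesis by (simp add: bessel_K_majorant_def)
qed

text \<open>Moving the argument costs a factor \<open>cosh t\<close> under the integral sign, which half of the exponential
decay absorbs.\<close>
lemma bessel_K_lipschitz:
  assumes u0: "u0 > 0" and u: "u0 \<le> u" "u \<le> u'"
  shows "cmod (bessel_K s u' - bessel_K s u) \<le> 2 / u0 * bessel_K_majorant s (u0 / 2) * (u' - u)"
proof -
  have i1: "(\<lambda>t. of_real (exp (- u' * cosh t)) * cosh (s * of_real t) -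
      of_real (exp (- u * cosh t)) * cosh (s * of_real t)) integrable_on {0..}"
    using u0 u by (intro integrable_diff bessel_integrable) auto
  have i2: "(\<lambda>t. (2 / u0 * (u' - u)) *
      (exp (- (u0 / 2) * cosh t) * cmod (cosh (s * of_real t)))) integrable_on {0..}"
    using u0 by (intro integrable_on_mult_right bessel_majorant_integrable) simp
  have "bessel_K s u' - bessel_K s u =
      integral {0..} (\<lambda>t. of_real (exp (- u' * cosh t)) * cosh (s * of_real t) -
                          of_real (exp (- u * cosh t)) * cosh (s * of_real t))"
    unfolding bessel_K_def using u0 u by (intro integral_diff[symmetric] bessel_integrable) auto
  also have "cmod \<dots> \<le> integral {0..} (\<lambda>t. (2 / u0 * (u' - u)) *
      (exp (- (u0 / 2) * cosh t) * cmod (cosh (s * of_real t))))"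
  proof (rule integral_norm_bound_integral[OF i1 i2])
    fix t :: real
    have "\<bar>exp (- u' * cosh t) - exp (- u * cosh t)\<bar> = exp (- u * cosh t) * (1 - exp (- ((u' - u) * cosh t)))"
      using u by (simp add: algebra_simps mult_right_mono flip: exp_add)
    also have "\<dots> \<le> exp (- u0 * cosh t) * ((u' - u) * cosh t)"
    proof (intro mult_mono)
      show "1 - exp (- ((u' - u) * cosh t)) \<le> (u' - u) * cosh t"
        using exp_ge_add_one_self[of "- ((u' - u) * cosh t)"] by simp
      show "exp (- u * cosh t) \<le> exp (- u0 * cosh t)"
        using u by (simp add: mult_right_mono)
    qed (use u in \<open>auto simp: mult_nonneg_nonneg\<close>)
    also have "\<dots> \<le> 2 / u0 * (u' - u) * exp (- (u0 / 2) * cosh t)"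
    proof -
      have "u0 / 2 * cosh t \<le> exp (u0 / 2 * cosh t)"
        using exp_ge_add_one_self[of "u0 / 2 * cosh t"] by linarith
      then have "exp (- u0 * cosh t) * (u0 / 2 * cosh t) \<le> exp (- u0 * cosh t) * exp (u0 / 2 * cosh t)"
        by (intro mult_left_mono) auto
      also have "\<dots> = exp (- (u0 / 2) * cosh t)"
        by (simp flip: exp_add)
      finally have "2 / u0 * (u' - u) * (exp (- u0 * cosh t) * (u0 / 2 * cosh t)) \<le>
          2 / u0 * (u' - u) * exp (- (u0 / 2) * cosh t)"
        using u u0 by (intro mult_left_mono) auto
      moreover have "2 / u0 * (u' - u) * (exp (- u0 * cosh t) * (u0 / 2 * cosh t)) =
          exp (- u0 * cosh t) * ((u' - u) * cosh t)"
        using u0 by simp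
      ultimately show ?thesis by simp
    qed
    finally have "\<bar>exp (- u' * cosh t) - exp (- u * cosh t)\<bar> * cmod (cosh (s * of_real t)) \<le>
        2 / u0 * (u' - u) * exp (- (u0 / 2) * cosh t) * cmod (cosh (s * of_real t))"
      by (intro mult_right_mono) auto
    then show "norm (of_real (exp (- u' * cosh t)) * cosh (s * of_real t) -
        of_real (exp (- u * cosh t)) * cosh (s * of_real t)) \<le>
        (2 / u0 * (u' - u)) * (exp (- (u0 / 2) * cosh t) * cmod (cosh (s * of_real t)))"
      by (simp only: left_diff_distrib[symmetric] of_real_diff[symmetric] norm_mult norm_of_real
                     mult.assoc)
  qed
  also have "\<dots> = 2 / u0 * bessel_K_majorant s (u0 / 2) * (u' - u)"
    by (simp add: bessel_K_majorant_def)
  finally show ?thesis .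
qed

text \<open>Laplace's method in its crudest form.  Near \<open>t = 0\<close> the factor \<open>cosh (s * t)\<close> has real part at least
\<open>1 / 2\<close>, say on \<open>[0, 2 * t1]\<close>.  The interval \<open>[0, t1]\<close> contributes at least a constant times
\<open>exp (- u * cosh t1)\<close>, and the part beyond \<open>2 * t1\<close> is \<open>O(exp (- u * cosh (2 * t1)))\<close>, which is smaller
for large \<open>u\<close>.  The lower bound serves twice: it provides an interval on which \<open>K\<^sub>s\<close> has no zeros,
and it turns convergence of the Fourier expansion into a growth bound for the coefficients.\<close>
lemma bessel_K_lower_bound:
  obtains u0 a c :: real where "u0 \<ge> 1" "c > 0" "a \<ge> 0"
    "\<And>u. u \<ge> u0 \<Longrightarrow> cmod (bessel_K s u) \<ge> c * exp (- a * u)"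
proof -
  have "isCont (\<lambda>t::real. Re (cosh (s * of_real t))) 0"
    by (rule continuous_on_interior[of UNIV]) (auto intro!: continuous_intros)
  then have "((\<lambda>t::real. Re (cosh (s * of_real t))) \<longlongrightarrow> 1) (at 0)"
    by (simp add: isCont_def)
  then have "\<forall>\<^sub>F t in at (0::real). Re (cosh (s * of_real t)) > 1 / 2"
    by (rule order_tendstoD) simp
  then obtain d where d: "d > 0" and dR: "\<And>t::real. t \<noteq> 0 \<Longrightarrow> \<bar>t\<bar> < d \<Longrightarrow> Re (cosh (s * of_real t)) > 1 / 2"
    by (auto simp: eventually_at dist_real_def)
  define t1 where "t1 = d / 3"
  have t1: "t1 > 0" using d by (simp add: t1_def)
  have half: "Re (cosh (s * of_real t)) \<ge> 1 / 2" if "0 \<le> t" "t \<le> 2 * t1" for t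
    using dR[of t] that d by (cases "t = 0") (auto simp: t1_def less_imp_le)
  define a b where "a = cosh t1" and "b = cosh (2 * t1)"
  have ab: "a < b" unfolding a_def b_def using t1 cosh_real_nonneg_less_iff[of t1 "2 * t1"] by simp
  define M where "M = bessel_K_majorant s 1"
  have M0: "M \<ge> 0" by (simp add: M_def bessel_K_majorant_nonneg)
  have lower: "cmod (bessel_K s u) \<ge> t1 / 2 * exp (- a * u) - M * exp (- b * (u - 1))" if u: "u \<ge> 1" for u
  proof -
    define low where "low = (\<lambda>t. (if t \<in> {0..t1} then 1 / 2 * exp (- a * u) else 0) -
        exp (- 1 * cosh t) * cmod (cosh (s * of_real t)) * exp (- b * (u - 1)))"
    have "((\<lambda>t. if t \<in> {0..t1} then 1 / 2 * exp (- a * u) else 0) has_integral (t1 / 2 * exp (- a * u))) {0..}"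
      using has_integral_const_real[of "1 / 2 * exp (- a * u)" 0 t1] t1
      by (subst has_integral_restrict) auto
    moreover have "((\<lambda>t. exp (- 1 * cosh t) * cmod (cosh (s * of_real t)) * exp (- b * (u - 1)))
        has_integral M * exp (- b * (u - 1))) {0..}"
      unfolding M_def bessel_K_majorant_def
      by (intro has_integral_mult_left integrable_integral bessel_majorant_integrable) auto
    ultimately have low: "(low has_integral (t1 / 2 * exp (- a * u) - M * exp (- b * (u - 1)))) {0..}"
      unfolding low_def by (rule has_integral_diff)
    have "((\<lambda>t. of_real (exp (- u * cosh t)) * cosh (s * of_real t)) has_integral bessel_K s u) {0..}"
      unfolding bessel_K_def using u by (intro integrable_integral bessel_integrable) auto
    from has_integral_Re[OF this] have "((\<lambda>t. exp (- u * cosh t) * Re (cosh (s * of_real t))) has_integral Re (bessel_K s u)) {0..}"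
      by simp
    then have "t1 / 2 * exp (- a * u) - M * exp (- b * (u - 1)) \<le> Re (bessel_K s u)"
    proof (rule has_integral_le[OF low])
      fix t :: real assume "t \<in> {0..}"
      then have t: "t \<ge> 0" by simp
      define N where "N = cmod (cosh (s * of_real t))"
      have tail0: "exp (- 1 * cosh t) * N * exp (- b * (u - 1)) \<ge> 0" by (simp add: N_def)
      have tail: "exp (- u * cosh t) * N \<le> exp (- 1 * cosh t) * N * exp (- b * (u - 1))" if "t \<ge> 2 * t1"
      proof -
        have "b \<le> cosh t" unfolding b_def
          using that t1 t cosh_real_nonneg_le_iff[of "2 * t1" t] by simp
        then have "b * (u - 1) \<le> cosh t * (u - 1)" using u by (intro mult_right_mono) auto
        then have "exp (- u * cosh t) \<le> exp (- 1 * cosh t) * exp (- b * (u - 1))"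
          by (simp add: algebra_simps flip: exp_add)
        then have "exp (- u * cosh t) * N \<le> exp (- 1 * cosh t) * exp (- b * (u - 1)) * N"
          by (intro mult_right_mono) (auto simp: N_def)
        then show ?thesis by (simp add: mult_ac)
      qed
      consider "t \<le> t1" | "t1 < t" "t \<le> 2 * t1" | "2 * t1 < t" by linarith
      then show "low t \<le> exp (- u * cosh t) * Re (cosh (s * of_real t))"
      proof cases
        case 1
        have "cosh t \<le> a" unfolding a_def using 1 t t1 cosh_real_nonneg_le_iff[of t t1] by simp
        then have "exp (- a * u) \<le> exp (- u * cosh t)" using u by (simp add: mult.commute)
        then have "exp (- a * u) * (1 / 2) \<le> exp (- u * cosh t) * Re (cosh (s * of_real t))"
          using half[of t] 1 t t1 by (intro mult_mono) auto
        moreover have "low t = exp (- a * u) * (1 / 2) - exp (- 1 * cosh t) * N * exp (- b * (u - 1))"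
          using 1 t by (simp add: low_def N_def)
        ultimately show ?thesis using tail0 by linarith
      next
        case 2
        then have "0 \<le> exp (- u * cosh t) * Re (cosh (s * of_real t))"
          using half[of t] t by (intro mult_nonneg_nonneg) auto
        moreover have "low t = - (exp (- 1 * cosh t) * N * exp (- b * (u - 1)))"
          using 2 by (simp add: low_def N_def)
        ultimately show ?thesis using tail0 by linarith
      next
        case 3
        have "exp (- u * cosh t) * (- N) \<le> exp (- u * cosh t) * Re (cosh (s * of_real t))"
          using abs_Re_le_cmod[of "cosh (s * of_real t)"] unfolding N_def
          by (intro mult_left_mono) auto
        moreover have "low t = - (exp (- 1 * cosh t) * N * exp (- b * (u - 1)))"
          using 3 t1 by (simp add: low_def N_def)
        ultimately show ?thesis using tail 3 by linarith
      qed
    qed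
    then show ?thesis using complex_Re_le_cmod[of "bessel_K s u"] by (rule order_trans)
  qed
  \<comment> \<open>Beyond this point the tail is at most half of the main contribution.\<close>
  define u0 where "u0 = max 1 (ln (4 * (M + 1) * exp b / t1) / (b - a))"
  have tail_small: "M * exp (- b * (u - 1)) \<le> t1 / 4 * exp (- a * u)" if "u \<ge> u0" for u
  proof -
    have "ln (4 * (M + 1) * exp b / t1) / (b - a) \<le> u" using that by (simp add: u0_def)
    then have "ln (4 * (M + 1) * exp b / t1) \<le> (b - a) * u"
      using ab by (simp add: field_simps)
    then have "exp (ln (4 * (M + 1) * exp b / t1)) \<le> exp ((b - a) * u)" by simp
    moreover have "exp (ln (4 * (M + 1) * exp b / t1)) = 4 * (M + 1) * exp b / t1"
      using M0 t1 by (intro exp_ln) simp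
    ultimately have "4 * (M + 1) * exp b / t1 \<le> exp ((b - a) * u)" by (simp only:)
    then have "(M + 1) * exp b \<le> t1 / 4 * exp ((b - a) * u)"
      using t1 by (simp add: field_simps)
    then have "(M + 1) * exp b * exp (- b * u) \<le> t1 / 4 * exp ((b - a) * u) * exp (- b * u)"
      by (rule mult_right_mono) simp
    also have "t1 / 4 * exp ((b - a) * u) * exp (- b * u) = t1 / 4 * exp (- a * u)"
      by (simp only: mult.assoc exp_add[symmetric]) (simp add: algebra_simps)
    also have "(M + 1) * exp b * exp (- b * u) = (M + 1) * exp (- b * (u - 1))"
      by (simp only: mult.assoc exp_add[symmetric]) (simp add: algebra_simps)
    finally have "(M + 1) * exp (- b * (u - 1)) \<le> t1 / 4 * exp (- a * u)" .
    moreover have "M * exp (- b * (u - 1)) \<le> (M + 1) * exp (- b * (u - 1))"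
      by (intro mult_right_mono) auto
    ultimately show ?thesis by linarith
  qed
  show ?thesis
  proof (rule that[of u0 "t1 / 4" a])
    show "t1 / 4 * exp (- a * u) \<le> cmod (bessel_K s u)" if "u \<ge> u0" for u
    proof -
      have "u \<ge> 1" using that unfolding u0_def by (rule max.boundedE)
      from lower[OF this] tail_small[OF that] show ?thesis by linarith
    qed
  qed (use t1 in \<open>auto simp: u0_def a_def\<close>)
qed

section \<open>Boundedness on the upper half-plane\<close>

lemma cmod_e2pi: "cmod (e2pi z) = exp (- (2 * pi * Im z))"
  by (simp add: e2pi_def norm_exp_eq_Re mult.commute mult.left_commute)

lemma e2pi_of_real: "e2pi (of_real x) = cis (2 * pi * x)"
  by (simp add: e2pi_def cis_conv_exp mult_ac)

text \<open>A substitute for the fundamental domain.  By Dirichlet's approximation theorem, applied to \<open>Re z\<close> with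
denominators up to \<open>1 / sqrt (Im z)\<close>, there is a coprime pair \<open>(c, d)\<close> with
\<open>(cmod (c * z + d))\<^sup>2 \<le> 5 * Im z\<close>.  A matrix with this bottom row moves \<open>z\<close> to height at least \<open>1 / 5\<close>.\<close>
lemma exists_matrix_Im_ge:
  assumes y: "Im z > 0" "Im z \<le> 1"
  obtains a b c d :: int where "a * d - b * c = 1" "of_int c * z + of_int d \<noteq> 0"
    "(cmod (of_int c * z + of_int d))\<^sup>2 \<le> 5 * Im z"
proof -
  define N where "N = nat \<lfloor>1 / sqrt (Im z)\<rfloor>"
  have sq: "1 / sqrt (Im z) \<ge> 1" using y by simp
  then have N1: "N \<ge> 1" unfolding N_def by linarith
  have N_le: "real N \<le> 1 / sqrt (Im z)" using sq unfolding N_def by linarith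
  have N_ge: "1 / sqrt (Im z) \<le> 2 * real N"
    using N1 real_of_int_floor_add_one_gt[of "1 / sqrt (Im z)"] sq unfolding N_def by linarith
  obtain h k where hk: "coprime h k" "0 < k" "k \<le> int N" "\<bar>of_int k * Re z - of_int h\<bar> < 1 / N"
    using Dirichlet_approx_coprime[of N "Re z"] N1 by auto
  obtain p q where pq: "p * h + q * k = 1"
    using bezout_int[of h k] hk(1) by (auto simp: coprime_iff_gcd_eq_1)
  define w where "w = of_int k * z + of_int (- h)"
  have Rew: "Re w = of_int k * Re z - of_int h" and Imw: "Im w = of_int k * Im z"
    by (simp_all add: w_def)
  have N2: "(real N)\<^sup>2 * Im z \<le> 1" "1 \<le> 4 * (real N)\<^sup>2 * Im z"
  proof -
    have "real N * sqrt (Im z) \<le> 1" "1 \<le> 2 * real N * sqrt (Im z)"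
      using N_le N_ge y by (simp_all add: field_simps)
    then have "(real N * sqrt (Im z))\<^sup>2 \<le> 1" "1 \<le> (2 * real N * sqrt (Im z))\<^sup>2"
      using y by (auto intro: power_le_one one_le_power)
    then show "(real N)\<^sup>2 * Im z \<le> 1" "1 \<le> 4 * (real N)\<^sup>2 * Im z"
      using y by (simp_all add: power_mult_distrib)
  qed
  have "(Re w)\<^sup>2 \<le> (1 / real N)\<^sup>2"
    using hk(4) unfolding Rew by (intro power2_le_iff_abs_le[THEN iffD2]) auto
  also have "\<dots> \<le> 4 * Im z"
    using N2(2) N1 by (simp add: power_divide field_simps)
  finally have 1: "(Re w)\<^sup>2 \<le> 4 * Im z" .
  have "(Im w)\<^sup>2 \<le> (real N * Im z)\<^sup>2"
    unfolding Imw using hk(2,3) y by (intro power_mono mult_right_mono) auto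
  also have "\<dots> = ((real N)\<^sup>2 * Im z) * Im z" by (simp add: power2_eq_square)
  also have "\<dots> \<le> 1 * Im z" using N2(1) y by (intro mult_right_mono) auto
  finally have 2: "(Im w)\<^sup>2 \<le> Im z" by simp
  have "Im w > 0" unfolding Imw using hk(2) y by simp
  then have "w \<noteq> 0" by auto
  moreover have "(cmod w)\<^sup>2 \<le> 5 * Im z" using 1 2 by (simp add: cmod_power2)
  moreover have "(- p) * (- h) - (- q) * k = 1" using pq by simp
  ultimately show ?thesis using that[of "- p" "- h" "- q" k] by (simp add: w_def)
qed

lemma Im_moebius:
  assumes "a * d - b * c = (1::int)"
  shows "Im ((of_int a * z + of_int b) / (of_int c * z + of_int d)) =
           Im z / (cmod (of_int c * z + of_int d))\<^sup>2"
proof -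
  define w where "w = of_int c * z + of_int d"
  have "real_of_int a * real_of_int d - real_of_int b * real_of_int c = 1"
    using assms by (metis of_int_1 of_int_diff of_int_mult)
  then have "Im (of_int a * z + of_int b) * Re w - Re (of_int a * z + of_int b) * Im w = Im z * 1"
    by (simp add: w_def algebra_simps)
  then show ?thesis
    unfolding w_def[symmetric] Im_divide cmod_power2 by simp
qed

text \<open>The function \<open>cmod (f z) * Im z powr (\<kappa> / 2)\<close> is invariant under the modular group, and every orbit
reaches height \<open>1 / 5\<close>.\<close>
lemma modular_form_bounded:
  assumes mod: "modular_of_weight \<kappa> f"
    and B: "\<And>z. Im z \<ge> 1 / 5 \<Longrightarrow> cmod (f z) * Im z powr (of_int \<kappa> / 2) \<le> B"
    and z: "Im z > 0"
  shows "cmod (f z) * Im z powr (of_int \<kappa> / 2) \<le> B"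
proof (cases "Im z \<ge> 1 / 5")
  case False
  then have "Im z \<le> 1" by simp
  then obtain a b c d :: int where det: "a * d - b * c = 1"
    and nz: "of_int c * z + of_int d \<noteq> 0"
    and le: "(cmod (of_int c * z + of_int d))\<^sup>2 \<le> 5 * Im z"
    using exists_matrix_Im_ge[OF z] by metis
  define w where "w = of_int c * z + of_int d"
  define z' where "z' = (of_int a * z + of_int b) / (of_int c * z + of_int d)"
  have w: "cmod w > 0" using nz by (simp add: w_def)
  have Im: "Im z' = Im z / (cmod w)\<^sup>2"
    unfolding z'_def w_def using Im_moebius[OF det] .
  have "f z' = w powi \<kappa> * f z"
    using mod det z unfolding modular_of_weight_def upper_half_plane_def z'_def w_def by blast
  then have "cmod (f z') = cmod w powr of_int \<kappa> * cmod (f z)"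
    using w by (simp add: norm_mult norm_power_int powr_real_of_int')
  moreover have "Im z' powr (of_int \<kappa> / 2) = Im z powr (of_int \<kappa> / 2) / cmod w powr of_int \<kappa>"
  proof -
    have "(cmod w)\<^sup>2 powr (of_int \<kappa> / 2) = (cmod w powr 2) powr (of_int \<kappa> / 2)"
      using w by simp
    also have "\<dots> = cmod w powr of_int \<kappa>" by (simp only: powr_powr) simp
    finally show ?thesis unfolding Im using z w by (simp add: powr_divide)
  qed
  ultimately have "cmod (f z') * Im z' powr (of_int \<kappa> / 2) = cmod (f z) * Im z powr (of_int \<kappa> / 2)"
    using w by simp
  moreover have "Im z' \<ge> 1 / 5"
    unfolding Im using le w unfolding w_def[symmetric] by (simp add: field_simps)
  ultimately show ?thesis using B[of z'] by simp
qed (use B in auto)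

lemma powr_times_exp_minus_bounded:
  obtains K where "\<And>y::real. y \<ge> 1 / 5 \<Longrightarrow> y powr p * exp (- y) \<le> K"
proof (cases "p > 0")
  case True
  have "y powr p * exp (- y) \<le> exp (p * ln p)" if "y \<ge> 1 / 5" for y
  proof -
    have "ln (y / p) \<le> y / p - 1" using that True by (intro ln_le_minus_one) auto
    then have "p * (ln y - ln p) \<le> y - p"
      using that True by (simp add: ln_div field_simps)
    then have "p * ln y - y \<le> p * ln p" using True by (simp add: algebra_simps)
    then have "exp (p * ln y - y) \<le> exp (p * ln p)" by simp
    then show ?thesis using that by (simp add: powr_def exp_diff exp_minus field_simps)
  qed
  then show ?thesis using that by blast
next
  case False
  have "y powr p * exp (- y) \<le> (1 / 5) powr p * 1" if "y \<ge> 1 / 5" for y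
    using that False by (intro mult_mono powr_mono2') auto
  then show ?thesis using that by blast
qed

lemma has_sum_norm_le_scaled:
  fixes t t0 :: "'i \<Rightarrow> complex"
  assumes "(t has_sum s) S" "t0 summable_on S"
    and "\<And>n. n \<in> S \<Longrightarrow> cmod (t n) \<le> E * cmod (t0 n)"
  shows "cmod s \<le> E * (\<Sum>\<^sub>\<infinity>n\<in>S. cmod (t0 n))"
proof (rule norm_infsum_le[OF assms(1) _ assms(3)])
  have "(\<lambda>n. cmod (t0 n)) summable_on S"
    using assms(2) summable_on_iff_abs_summable_on_complex by blast
  then show "((\<lambda>n. E * cmod (t0 n)) has_sum E * (\<Sum>\<^sub>\<infinity>n\<in>S. cmod (t0 n))) S"
    by (intro has_sum_cmult_right has_sum_infsum)
qed

text \<open>At height at least \<open>1 / 5\<close> the expansion is dominated by its values at height \<open>1 / 10\<close>, and the missing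
constant term makes it decay exponentially.  This beats any power of \<open>Im z\<close>.\<close>
lemma holomorphic_form_bounded:
  assumes mod: "modular_of_weight \<kappa> f"
    and coeffs: "holomorphic_normalized_coeffs \<kappa> f A"
  obtains B where "\<And>z. Im z > 0 \<Longrightarrow> cmod (f z) * Im z powr (of_int \<kappa> / 2) \<le> B"
proof -
  define g where "g = (\<lambda>n. A n * of_real (real_of_int n powr ((real_of_int \<kappa> - 1) / 2)))"
  have has: "((\<lambda>n. g n * e2pi (of_int n * z)) has_sum f z) {1..}" if "Im z > 0" for z
    using coeffs that unfolding holomorphic_normalized_coeffs_def upper_half_plane_def g_def by blast
  define z0 where "z0 = Complex 0 (1 / 10)"
  define H where "H = (\<Sum>\<^sub>\<infinity>n\<in>{1..}. cmod (g n * e2pi (of_int n * z0)))"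
  have H0: "H \<ge> 0" unfolding H_def by (rule infsum_nonneg) simp
  have dec: "cmod (f z) \<le> exp (- Im z) * H" if "Im z \<ge> 1 / 5" for z
    unfolding H_def
  proof (rule has_sum_norm_le_scaled)
    show "((\<lambda>n. g n * e2pi (of_int n * z)) has_sum f z) {1..}" using that by (intro has) simp
    show "(\<lambda>n. g n * e2pi (of_int n * z0)) summable_on {1..}"
      by (rule has_sum_imp_summable[OF has]) (simp add: z0_def)
    fix n :: int assume n: "n \<in> {1..}"
    define r where "r = pi * real_of_int n"
    have "1 * 1 \<le> r"
      unfolding r_def using n pi_ge_two by (intro mult_mono) auto
    then have "1 * Im z \<le> r * Im z" "r * (1 / 5) \<le> r * Im z"
      using that by (auto intro: mult_right_mono mult_left_mono)
    then have "Im z + r * (1 / 5) \<le> 2 * (r * Im z)" by linarith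
    then have "Im z + 2 * pi * (of_int n * (1 / 10)) \<le> 2 * pi * (of_int n * Im z)"
      by (simp add: r_def mult_ac)
    then have "exp (- (2 * pi * (of_int n * Im z))) \<le> exp (- Im z) * exp (- (2 * pi * (of_int n * (1 / 10))))"
      by (simp flip: exp_add)
    then have "cmod (g n) * exp (- (2 * pi * (of_int n * Im z))) \<le>
        cmod (g n) * (exp (- Im z) * exp (- (2 * pi * (of_int n * (1 / 10)))))"
      by (intro mult_left_mono) auto
    then show "cmod (g n * e2pi (of_int n * z)) \<le> exp (- Im z) * cmod (g n * e2pi (of_int n * z0))"
      by (simp add: norm_mult cmod_e2pi z0_def mult_ac)
  qed
  obtain K where K: "\<And>y::real. y \<ge> 1 / 5 \<Longrightarrow> y powr (of_int \<kappa> / 2) * exp (- y) \<le> K"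
    using powr_times_exp_minus_bounded[of "of_int \<kappa> / 2"] by blast
  have "cmod (f z) * Im z powr (of_int \<kappa> / 2) \<le> K * H" if "Im z \<ge> 1 / 5" for z
  proof -
    have "cmod (f z) * Im z powr (of_int \<kappa> / 2) \<le> exp (- Im z) * H * Im z powr (of_int \<kappa> / 2)"
      using dec[OF that] by (intro mult_right_mono) auto
    also have "\<dots> = (Im z powr (of_int \<kappa> / 2) * exp (- Im z)) * H" by (simp add: mult_ac)
    also have "\<dots> \<le> K * H" using K[OF that] H0 by (rule mult_right_mono)
    finally show ?thesis .
  qed
  then show ?thesis using modular_form_bounded[OF mod] that by blast
qed

lemma modular_shift:
  assumes "modular_of_weight 0 f" "Im z > 0"
  shows "f (z + of_int n) = f z"
  using assms(1)[unfolded modular_of_weight_def, rule_format, of 1 1 n 0 z] assms(2)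
  by (simp add: upper_half_plane_def)

text \<open>High in the cusp, comparing the upper bound for \<open>K\<^sub>s\<close> at height \<open>y\<close> with the lower bound at the fixed
height \<open>u0\<close> dominates the expansion at \<open>y\<close> by the one at \<open>u0\<close>, with exponential decay.  The two bounds
have different exponential rates, \<open>1\<close> and \<open>a\<close>, so this works only for \<open>y\<close> somewhat above \<open>a * u0\<close>.
What is left of a vertical strip is compact, and there continuity suffices.\<close>
lemma maass_form_bounded:
  assumes cont: "continuous_on upper_half_plane f"
    and mod: "modular_of_weight 0 f"
    and coeffs: "maass_normalized_coeffs \<nu> f A"
  obtains B where "\<And>z. Im z > 0 \<Longrightarrow> cmod (f z) \<le> B"
proof -
  define s where "s = \<i> * \<nu>"
  obtain u0 a c where u0: "u0 \<ge> 1" and c: "c > 0" and a: "a \<ge> 0"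
    and lower: "\<And>u. u \<ge> u0 \<Longrightarrow> cmod (bessel_K s u) \<ge> c * exp (- a * u)"
    using bessel_K_lower_bound[of s] by metis
  define M where "M = bessel_K_majorant s 1"
  have M0: "M \<ge> 0" by (simp add: M_def bessel_K_majorant_nonneg)
  define t where "t = (\<lambda>x y n. 2 * of_real (sqrt y) * A n * bessel_K s (2 * pi * \<bar>real_of_int n\<bar> * y) *
              e2pi (of_int n * of_real x))"
  have has: "(t x y has_sum f (Complex x y)) {n. n \<noteq> 0}" if "y > 0" for x y
    using coeffs that unfolding maass_normalized_coeffs_def t_def s_def by blast
  have e2pi1: "cmod (e2pi (of_int n * of_real x)) = 1" for n x
    by (simp add: cmod_e2pi)
  define H where "H = (\<Sum>\<^sub>\<infinity>n\<in>{n. n \<noteq> 0}. cmod (t 0 u0 n))"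
  have H0: "H \<ge> 0" unfolding H_def by (rule infsum_nonneg) simp
  define E where "E = M * exp (1 + a * u0) / (sqrt u0 * c)"
  have E0: "E \<ge> 0" using M0 u0 c by (simp add: E_def)
  define Y1 where "Y1 = a * u0 + 1"
  have Y1: "Y1 \<ge> 1" using a u0 by (simp add: Y1_def)
  have high: "cmod (f (Complex x y)) \<le> E * H" if y: "y \<ge> Y1" for x y
  proof -
    have "cmod (f (Complex x y)) \<le> sqrt y * exp (- y) * E * H"
      unfolding H_def
    proof (rule has_sum_norm_le_scaled[OF has has_sum_imp_summable[OF has]])
      fix n :: int assume "n \<in> {n. n \<noteq> 0}"
      then have n: "\<bar>real_of_int n\<bar> \<ge> 1" by auto
      define r where "r = 2 * pi * \<bar>real_of_int n\<bar>"
      have "1 * 1 \<le> 2 * pi * \<bar>real_of_int n\<bar>"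
        using n pi_ge_two by (intro mult_mono) auto
      then have r: "r \<ge> 1" by (simp add: r_def)
      have ru0: "r * u0 \<ge> u0" "r * y \<ge> 1"
        using r u0 Y1 y mult_mono[of 1 r u0 u0] mult_mono[of 1 r 1 y] by auto
      have "1 * (y - a * u0) \<le> r * (y - a * u0)"
        using r y by (intro mult_right_mono) (auto simp: Y1_def)
      then have "exp (1 - r * y) \<le> exp (- y) * exp (1 + a * u0) * exp (- a * (r * u0))"
        by (simp add: algebra_simps flip: exp_add)
      also have "\<dots> \<le> exp (- y) * exp (1 + a * u0) * (cmod (bessel_K s (r * u0)) / c)"
        using lower[OF ru0(1)] c by (intro mult_left_mono) (auto simp: field_simps)
      finally have ex: "exp (1 - r * y) \<le> exp (- y) * exp (1 + a * u0) * (cmod (bessel_K s (r * u0)) / c)" .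
      have "cmod (bessel_K s (r * y)) \<le> M * exp (1 - r * y)"
        unfolding M_def by (rule bessel_K_upper_bound[OF ru0(2)])
      also have "\<dots> \<le> M * (exp (- y) * exp (1 + a * u0) * (cmod (bessel_K s (r * u0)) / c))"
        by (rule mult_left_mono[OF ex M0])
      finally have Kb: "cmod (bessel_K s (r * y)) \<le> M * (exp (- y) * exp (1 + a * u0) * (cmod (bessel_K s (r * u0)) / c))" .
      have "cmod (t x y n) = 2 * sqrt y * cmod (A n) * cmod (bessel_K s (r * y))"
        using y Y1 by (simp add: t_def norm_mult e2pi1 r_def)
      also have "\<dots> \<le> 2 * sqrt y * cmod (A n) * (M * (exp (- y) * exp (1 + a * u0) * (cmod (bessel_K s (r * u0)) / c)))"
        using y Y1 by (intro mult_left_mono Kb) auto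
      also have "\<dots> = sqrt y * exp (- y) * E * (2 * sqrt u0 * cmod (A n) * cmod (bessel_K s (r * u0)))"
        using u0 c by (simp add: E_def field_simps)
      also have "2 * sqrt u0 * cmod (A n) * cmod (bessel_K s (r * u0)) = cmod (t 0 u0 n)"
        using u0 e2pi1[of n 0] by (simp add: t_def norm_mult r_def)
      finally show "cmod (t x y n) \<le> sqrt y * exp (- y) * E * cmod (t 0 u0 n)" .
    qed (use y Y1 u0 in auto)
    also have "\<dots> \<le> 1 * (E * H)"
    proof -
      have "sqrt y \<le> y" using y Y1 real_sqrt_le_mono[of y "y * y"] by (simp add: real_sqrt_mult_self)
      also have "y \<le> exp y" using exp_ge_add_one_self[of y] by linarith
      finally have "sqrt y * exp (- y) \<le> 1" by (simp add: exp_minus field_simps)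
      then have "sqrt y * exp (- y) * (E * H) \<le> 1 * (E * H)"
        using E0 H0 by (intro mult_right_mono) auto
      then show ?thesis by (simp add: mult.assoc)
    qed
    finally show ?thesis by simp
  qed
  define Q where "Q = cbox (Complex 0 (1 / 5)) (Complex 1 Y1)"
  have "compact (f ` Q)"
  proof (rule compact_continuous_image)
    show "continuous_on Q f"
      by (rule continuous_on_subset[OF cont]) (auto simp: Q_def upper_half_plane_def in_cbox_complex_iff)
  qed (simp add: Q_def)
  then obtain B1 where B1: "\<And>z. z \<in> Q \<Longrightarrow> cmod (f z) \<le> B1"
    by (meson bounded_iff compact_imp_bounded imageI)
  have "cmod (f z) * Im z powr (of_int 0 / 2) \<le> max B1 (E * H)" if z: "Im z \<ge> 1 / 5" for z
  proof (cases "Im z \<ge> Y1")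
    case True
    then show ?thesis using high[of "Im z" "Re z"] z by auto
  next
    case False
    define z' where "z' = z + of_int (- \<lfloor>Re z\<rfloor>)"
    have "f z' = f z" unfolding z'_def using modular_shift[OF mod, of z "- \<lfloor>Re z\<rfloor>"] z by simp
    moreover have "z' \<in> Q"
      using z False by (auto simp: Q_def z'_def in_cbox_complex_iff) linarith+
    ultimately show ?thesis using B1[of z'] z by auto
  qed
  then have "cmod (f z) * Im z powr (of_int 0 / 2) \<le> max B1 (E * H)" if "Im z > 0" for z
    using modular_form_bounded[OF mod _ that] by blast
  then show ?thesis using that[of "max B1 (E * H)"] by auto
qed

section \<open>Additive twists of the Fourier coefficients\<close>

lemma powr_exp_lipschitz:
  fixes p :: real
  obtains L where "\<And>u u'. 1 \<le> u \<Longrightarrow> u \<le> u' \<Longrightarrow> u' \<le> 2 \<Longrightarrow>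
    \<bar>u' powr p * exp (- (2 * pi * u')) - u powr p * exp (- (2 * pi * u))\<bar> \<le> L * (u' - u)"
proof -
  define w where "w = (\<lambda>u::real. u powr p * exp (- (2 * pi * u)))"
  define w' where "w' = (\<lambda>u::real. (p / u - 2 * pi) * w u)"
  have deriv: "(w has_real_derivative w' u) (at u within {1..2})" if "u \<in> {1..2}" for u
    unfolding w_def w'_def using that
    by (auto intro!: derivative_eq_intros simp: powr_diff field_simps)
  have "continuous_on {1..2} w'"
    unfolding w'_def w_def by (intro continuous_intros) auto
  then have "bounded (w' ` {1..2})"
    by (intro compact_imp_bounded compact_continuous_image) auto
  then obtain L where L: "\<And>u. u \<in> {1..2} \<Longrightarrow> norm (w' u) \<le> L"
    unfolding bounded_iff by blast
  have "\<bar>w u' - w u\<bar> \<le> L * (u' - u)" if "1 \<le> u" "u \<le> u'" "u' \<le> 2" for u u'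
    using field_differentiable_bound[of "{1..2}" w w' L u' u] deriv L that by simp
  then show ?thesis using that unfolding w_def by blast
qed

text \<open>Multiplying the expansion of \<open>f\<close> by \<open>y powr ((\<kappa> - 1) / 2)\<close> turns the powers of \<open>n\<close> into powers of
\<open>n * y\<close>, which gives the profile \<open>w u = u powr ((\<kappa> - 1) / 2) * exp (- 2 * pi * u)\<close>.  The remaining
half power of \<open>y\<close> is the factor \<open>1 / sqrt y\<close> demanded by Wilton's argument.\<close>
lemma holomorphic_exponential_sum_bound:
  assumes mod: "modular_of_weight \<kappa> f"
    and coeffs: "holomorphic_normalized_coeffs \<kappa> f A"
  shows "\<exists>C>0. \<forall>N x. cmod (\<Sum>k=1..N. A (int k) * cis (2 * pi * (real k * x))) \<le>
           C * sqrt (real N) * ln (1 + 2 * real N)"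
proof -
  define p where "p = (real_of_int \<kappa> - 1) / 2"
  obtain B where B: "\<And>z. Im z > 0 \<Longrightarrow> cmod (f z) * Im z powr (of_int \<kappa> / 2) \<le> B"
    using holomorphic_form_bounded[OF mod coeffs] by blast
  define w where "w = (\<lambda>u::real. complex_of_real (u powr p * exp (- (2 * pi * u))))"
  define G where "G = (\<lambda>x y. f (Complex x y) * of_real (y powr p))"
  obtain L where L: "\<And>u u'. 1 \<le> u \<Longrightarrow> u \<le> u' \<Longrightarrow> u' \<le> 2 \<Longrightarrow>
    \<bar>u' powr p * exp (- (2 * pi * u')) - u powr p * exp (- (2 * pi * u))\<bar> \<le> L * (u' - u)"
    using powr_exp_lipschitz[of p] by blast
  have m: "2 powr (- \<bar>p\<bar>) * exp (- (4 * pi)) \<le> cmod (w u)" if "1 \<le> u" "u \<le> 2" for u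
  proof -
    have "2 powr (- \<bar>p\<bar>) \<le> u powr (- \<bar>p\<bar>)" using that by (intro powr_mono2') auto
    also have "\<dots> \<le> u powr p" using that by (intro powr_mono) auto
    finally have "2 powr (- \<bar>p\<bar>) \<le> u powr p" .
    then have "2 powr (- \<bar>p\<bar>) * exp (- (4 * pi)) \<le> u powr p * exp (- (2 * pi * u))"
      using that by (intro mult_mono) auto
    then show ?thesis using that by (simp add: w_def norm_mult)
  qed
  show ?thesis
  proof (rule wilton_bound[where S = "{1..}" and G = G and w = w and B = B and ?u0.0 = 1 and L' = L])
    fix x y :: real assume y: "y > 0"
    have "((\<lambda>n. A n * of_real (real_of_int n powr p) * e2pi (of_int n * Complex x y) * of_real (y powr p))
        has_sum G x y) {1..}"
      using coeffs y unfolding G_def p_def holomorphic_normalized_coeffs_def upper_half_plane_def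
      by (intro has_sum_cmult_left) auto
    also have "?this \<longleftrightarrow> ((\<lambda>n. A n * w (\<bar>of_int n\<bar> * y) * cis (2 * pi * (of_int n * x))) has_sum G x y) {1..}"
    proof (rule has_sum_cong)
      fix n :: int assume n: "n \<in> {1..}"
      have "e2pi (of_int n * Complex x y) = of_real (exp (- (2 * pi * (of_int n * y)))) * cis (2 * pi * (of_int n * x))"
        by (simp add: e2pi_def complex_eq_iff Re_exp Im_exp mult_ac)
      moreover have "(of_int n * y) powr p = real_of_int n powr p * y powr p"
        using n y by (simp add: powr_mult)
      ultimately show "A n * of_real (real_of_int n powr p) * e2pi (of_int n * Complex x y) * of_real (y powr p)
          = A n * w (\<bar>of_int n\<bar> * y) * cis (2 * pi * (of_int n * x))"
        using n by (simp add: w_def mult_ac)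
    qed
    finally show "((\<lambda>n. A n * w (\<bar>of_int n\<bar> * y) * cis (2 * pi * (of_int n * x))) has_sum G x y) {1..}" .
    have *: "y powr p = y powr (of_int \<kappa> / 2) / sqrt y"
      using y by (simp add: p_def diff_divide_distrib powr_diff powr_half_sqrt)
    show "cmod (G x y) \<le> B / sqrt y"
    proof -
      have "cmod (G x y) = cmod (f (Complex x y)) * y powr p"
        by (simp add: G_def norm_mult)
      also have "\<dots> = (cmod (f (Complex x y)) * y powr (of_int \<kappa> / 2)) / sqrt y"
        using * by simp
      also have "\<dots> \<le> B / sqrt y"
        using B[of "Complex x y"] y by (intro divide_right_mono) auto
      finally show ?thesis .
    qed
  next
    fix u :: real assume "1 \<le> u" "u \<le> 2 * 1"
    then show "2 powr (- \<bar>p\<bar>) * exp (- (4 * pi)) \<le> cmod (w u)" using m by simp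
  next
    fix u u' :: real assume "1 \<le> u" "u \<le> u'" "u' \<le> 2 * 1"
    then show "cmod (w u' - w u) \<le> L * (u' - u)"
      using L[of u u'] unfolding w_def of_real_diff[symmetric] norm_of_real by simp
  qed auto
qed

text \<open>Here the profile is \<open>2 * K\<^sub>s (2 * pi * u)\<close> and the factor \<open>1 / sqrt y\<close> comes from the normalisation of
the expansion.\<close>
lemma maass_exponential_sum_bound:
  assumes cont: "continuous_on upper_half_plane f"
    and mod: "modular_of_weight 0 f"
    and coeffs: "maass_normalized_coeffs \<nu> f A"
  shows "\<exists>C>0. \<forall>N x. cmod (\<Sum>k=1..N. A (int k) * cis (2 * pi * (real k * x))) \<le>
           C * sqrt (real N) * ln (1 + 2 * real N)"
proof -
  define s where "s = \<i> * \<nu>"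
  obtain B where B: "\<And>z. Im z > 0 \<Longrightarrow> cmod (f z) \<le> B"
    using maass_form_bounded[OF assms] by blast
  obtain u0 a c where u0: "u0 \<ge> 1" and c: "c > 0" and a: "a \<ge> 0"
    and lower: "\<And>u. u \<ge> u0 \<Longrightarrow> cmod (bessel_K s u) \<ge> c * exp (- a * u)"
    using bessel_K_lower_bound[of s] by metis
  define w where "w = (\<lambda>u. 2 * bessel_K s (2 * pi * u))"
  define G where "G = (\<lambda>x y. f (Complex x y) * of_real (1 / sqrt y))"
  define m where "m = 2 * (c * exp (- a * (4 * pi * u0)))"
  define L where "L = 2 * (2 / u0 * bessel_K_majorant s (u0 / 2)) * (2 * pi)"
  have scaled: "u0 \<le> 2 * pi * u" if "u0 \<le> u" for u
  proof -
    have "1 * u0 \<le> (2 * pi) * u" using that u0 pi_ge_two by (intro mult_mono) auto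
    then show ?thesis by simp
  qed
  show ?thesis
  proof (rule wilton_bound[where S = "{n. n \<noteq> 0}" and G = G and w = w and B = B and ?u0.0 = u0
        and m = m and L' = L])
    fix x y :: real assume y: "y > 0"
    have "((\<lambda>n. 2 * of_real (sqrt y) * A n * bessel_K s (2 * pi * \<bar>real_of_int n\<bar> * y) *
              e2pi (of_int n * of_real x) * of_real (1 / sqrt y)) has_sum G x y) {n. n \<noteq> 0}"
      using coeffs y unfolding G_def s_def maass_normalized_coeffs_def
      by (intro has_sum_cmult_left) auto
    also have "(\<lambda>n. 2 * of_real (sqrt y) * A n * bessel_K s (2 * pi * \<bar>real_of_int n\<bar> * y) *
              e2pi (of_int n * of_real x) * of_real (1 / sqrt y)) =
        (\<lambda>n. A n * w (\<bar>of_int n\<bar> * y) * cis (2 * pi * (of_int n * x)))"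
    proof
      fix n :: int
      have "e2pi (of_int n * of_real x) = cis (2 * pi * (of_int n * x))"
        using e2pi_of_real[of "of_int n * x"] by simp
      then show "2 * of_real (sqrt y) * A n * bessel_K s (2 * pi * \<bar>real_of_int n\<bar> * y) *
              e2pi (of_int n * of_real x) * of_real (1 / sqrt y) =
          A n * w (\<bar>of_int n\<bar> * y) * cis (2 * pi * (of_int n * x))"
        using y by (simp add: w_def mult_ac)
    qed
    finally show "((\<lambda>n. A n * w (\<bar>of_int n\<bar> * y) * cis (2 * pi * (of_int n * x))) has_sum G x y) {n. n \<noteq> 0}" .
    show "cmod (G x y) \<le> B / sqrt y"
      using B[of "Complex x y"] y by (simp add: G_def norm_mult norm_divide divide_right_mono)
  next
    fix u :: real assume u: "u0 \<le> u" "u \<le> 2 * u0"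
    have "a * (2 * pi * u) \<le> a * (4 * pi * u0)"
      using u a by (intro mult_left_mono) auto
    then have "c * exp (- a * (4 * pi * u0)) \<le> c * exp (- a * (2 * pi * u))"
      using c by (intro mult_left_mono) auto
    with lower[OF scaled[OF u(1)]] show "m \<le> cmod (w u)"
      by (simp add: m_def w_def norm_mult)
  next
    fix u u' :: real assume u: "u0 \<le> u" "u \<le> u'" "u' \<le> 2 * u0"
    have "cmod (bessel_K s (2 * pi * u') - bessel_K s (2 * pi * u)) \<le>
        2 / u0 * bessel_K_majorant s (u0 / 2) * (2 * pi * u' - 2 * pi * u)"
      using u u0 by (intro bessel_K_lipschitz scaled) auto
    also have "2 * pi * u' - 2 * pi * u = 2 * pi * (u' - u)" by (rule right_diff_distrib[symmetric])
    also have "2 / u0 * bessel_K_majorant s (u0 / 2) * (2 * pi * (u' - u)) = L * (u' - u) / 2"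
      by (simp add: L_def)
    finally show "cmod (w u' - w u) \<le> L * (u' - u)"
      unfolding w_def right_diff_distrib[symmetric] norm_mult by simp
  qed (use u0 c in \<open>auto simp: m_def\<close>)
qed

section \<open>The bilinear form\<close>

text \<open>The logarithm is traded for \<open>X powr (1 / 8)\<close>, which is the room left by \<open>powr_five_eighths_le\<close>.\<close>
lemma sqrt_times_log_le_powr:
  assumes "X \<ge> 1" "0 \<le> N" "N \<le> 2 * X"
  shows "sqrt N * ln (1 + 2 * N) \<le> 80 * X powr (5 / 8)"
proof -
  have "sqrt N \<le> sqrt (4 * X)" using assms by simp
  also have "\<dots> = 2 * X powr (1 / 2)" using assms by (simp add: real_sqrt_mult powr_half_sqrt)
  finally have 1: "sqrt N \<le> 2 * X powr (1 / 2)" .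
  have "ln (1 + 2 * N) \<le> (1 + 2 * N) powr (1 / 8) / (1 / 8)"
    using assms by (intro ln_powr_bound) auto
  also have "\<dots> \<le> (5 * X) powr (1 / 8) / (1 / 8)"
    using assms by (intro divide_right_mono powr_mono2) auto
  also have "\<dots> = 8 * (5 powr (1 / 8) * X powr (1 / 8))"
    using assms by (simp add: powr_mult)
  also have "\<dots> \<le> 8 * (5 * X powr (1 / 8))"
    using powr_mono[of "1 / 8" 1 "5::real"] by (intro mult_left_mono mult_right_mono) auto
  finally have 2: "ln (1 + 2 * N) \<le> 40 * X powr (1 / 8)" by simp
  have "sqrt N * ln (1 + 2 * N) \<le> (2 * X powr (1 / 2)) * (40 * X powr (1 / 8))"
    using 1 2 assms by (intro mult_mono) auto
  also have "\<dots> = 80 * (X powr (1 / 2) * X powr (1 / 8))" by simp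
  also have "X powr (1 / 2) * X powr (1 / 8) = X powr (5 / 8)"
    by (simp flip: powr_add)
  finally show ?thesis .
qed

text \<open>Up to the factor \<open>(X * Y) powr \<epsilon>\<close> the right-hand side is \<open>X powr (7 / 8) * Y powr (- 1 / 4)\<close>, which
for \<open>Y \<le> X\<close> is smallest at \<open>Y = X\<close>.\<close>
lemma powr_five_eighths_le:
  assumes X: "X \<ge> 1" and Y: "Y \<ge> 1" and YX: "Y \<le> X" and e: "\<epsilon> > (0::real)"
  shows "X powr (5 / 8) \<le> (X powr (3 / 8) / Y powr (3 / 4)) * (X * Y) powr (1 / 2 + \<epsilon>)"
proof -
  have "X powr (5 / 8) * Y powr (3 / 4) = X powr (5 / 8) * (Y powr (1 / 4) * Y powr (1 / 2))"
    by (simp flip: powr_add)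
  also have "\<dots> \<le> X powr (5 / 8) * (X powr (1 / 4) * Y powr (1 / 2))"
    using assms by (intro mult_left_mono mult_right_mono powr_mono2) auto
  also have "\<dots> = X powr (3 / 8) * (X powr (1 / 2) * Y powr (1 / 2))"
    by (simp flip: powr_add add: mult.assoc[symmetric])
  also have "\<dots> = X powr (3 / 8) * (X * Y) powr (1 / 2)"
    using X Y by (simp add: powr_mult)
  also have "\<dots> \<le> X powr (3 / 8) * (X * Y) powr (1 / 2 + \<epsilon>)"
    using X Y e mult_mono[of 1 X 1 Y] by (intro mult_left_mono powr_mono) auto
  finally show ?thesis
    using Y by (simp add: pos_le_divide_eq mult.commute)
qed

theorem theorem1p1:
  fixes f :: "complex \<Rightarrow> complex" and A :: "int \<Rightarrow> complex"
  assumes "(\<exists>\<kappa>. holomorphic_cusp_form \<kappa> f \<and> hecke_eigenform \<kappa> f \<and>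
                  holomorphic_normalized_coeffs \<kappa> f A) \<or>
           (\<exists>\<nu>. maass_cusp_form \<nu> f \<and> hecke_eigenform 0 f \<and>
                  maass_normalized_coeffs \<nu> f A)"
  shows "(\<forall>\<epsilon>>0. \<exists>C>0. \<forall>(X::real) (Y::real) (a :: nat \<Rightarrow> complex) (b :: nat \<Rightarrow> complex).
           X \<ge> 1 \<longrightarrow> Y \<ge> 1 \<longrightarrow> Y < X powr (1 - \<epsilon>) \<longrightarrow>
           cmod (\<Sum>n = 1..nat \<lfloor>X\<rfloor>. \<Sum>m = 1..nat \<lfloor>Y\<rfloor>. a n * b m * A (int (n + m))) \<le>
             C * L2_set (\<lambda>n. cmod (a n)) {1..nat \<lfloor>X\<rfloor>} *
                 L2_set (\<lambda>m. cmod (b m)) {1..nat \<lfloor>Y\<rfloor>} *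
                 (X powr (3 / 8) / Y powr (3 / 4)) * (X * Y) powr (1 / 2 + \<epsilon>)) \<and>
         (\<forall>\<epsilon>>0. \<forall>(X::real) (Y::real).
           X \<ge> 1 \<longrightarrow> Y \<ge> 1 \<longrightarrow> X powr (1 / 2) < Y \<longrightarrow> Y < X powr (1 - \<epsilon>) \<longrightarrow>
           X powr (3 / 8) / Y powr (3 / 4) < 1)"
proof (intro conjI allI impI)
  have "\<exists>C>0. \<forall>N x. cmod (\<Sum>k=1..N. A (int k) * cis (2 * pi * (real k * x))) \<le>
           C * sqrt (real N) * ln (1 + 2 * real N)"
    using assms
  proof (elim disjE exE conjE)
    fix \<kappa> assume "holomorphic_cusp_form \<kappa> f" "holomorphic_normalized_coeffs \<kappa> f A"
    then show ?thesis
      by (intro holomorphic_exponential_sum_bound) (auto simp: holomorphic_cusp_form_def)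
  next
    fix \<nu> assume *: "maass_cusp_form \<nu> f" "maass_normalized_coeffs \<nu> f A"
    then have "real_Ck_on 0 f upper_half_plane"
      unfolding maass_cusp_form_def real_smooth_on_def by blast
    with * show ?thesis
      by (intro maass_exponential_sum_bound) (auto simp: maass_cusp_form_def)
  qed
  then obtain C where C: "C > 0" and sum_bound: "\<And>N x.
      cmod (\<Sum>k=1..N. A (int k) * cis (2 * pi * (real k * x))) \<le> C * sqrt (real N) * ln (1 + 2 * real N)"
    by blast
  fix \<epsilon> :: real assume e: "\<epsilon> > 0"
  show "\<exists>C>0. \<forall>(X::real) (Y::real) (a :: nat \<Rightarrow> complex) (b :: nat \<Rightarrow> complex).
           X \<ge> 1 \<longrightarrow> Y \<ge> 1 \<longrightarrow> Y < X powr (1 - \<epsilon>) \<longrightarrow>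
           cmod (\<Sum>n = 1..nat \<lfloor>X\<rfloor>. \<Sum>m = 1..nat \<lfloor>Y\<rfloor>. a n * b m * A (int (n + m))) \<le>
             C * L2_set (\<lambda>n. cmod (a n)) {1..nat \<lfloor>X\<rfloor>} *
                 L2_set (\<lambda>m. cmod (b m)) {1..nat \<lfloor>Y\<rfloor>} *
                 (X powr (3 / 8) / Y powr (3 / 4)) * (X * Y) powr (1 / 2 + \<epsilon>)"
  proof (intro exI[of _ "80 * C"] conjI allI impI)
    fix X Y :: real and a b :: "nat \<Rightarrow> complex"
    assume X: "X \<ge> 1" and Y: "Y \<ge> 1" and YX: "Y < X powr (1 - \<epsilon>)"
    have "X powr (1 - \<epsilon>) \<le> X powr 1" using X e by (intro powr_mono) auto
    with YX X have YX': "Y \<le> X" by simp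
    define P where "P = nat \<lfloor>X\<rfloor>"
    define Q where "Q = nat \<lfloor>Y\<rfloor>"
    define na where "na = L2_set (\<lambda>n. cmod (a n)) {1..P}"
    define nb where "nb = L2_set (\<lambda>m. cmod (b m)) {1..Q}"
    have nn: "na \<ge> 0" "nb \<ge> 0" by (auto simp: na_def nb_def)
    have PQ: "real (P + Q) \<le> 2 * X" using X Y YX' unfolding P_def Q_def by (simp, linarith)
    have "cmod (\<Sum>n=1..P. \<Sum>m=1..Q. a n * b m * A (int (n + m))) \<le>
        C * sqrt (real (P + Q)) * ln (1 + 2 * real (P + Q)) * na * nb"
      unfolding na_def nb_def by (rule hankel_form_bound) (rule sum_bound)
    also have "\<dots> = C * (sqrt (real (P + Q)) * ln (1 + 2 * real (P + Q))) * na * nb"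
      by simp
    also have "\<dots> \<le> C * (80 * X powr (5 / 8)) * na * nb"
      using C nn X PQ by (intro mult_right_mono mult_left_mono sqrt_times_log_le_powr) auto
    also have "\<dots> \<le> C * (80 * ((X powr (3 / 8) / Y powr (3 / 4)) * (X * Y) powr (1 / 2 + \<epsilon>))) * na * nb"
      using C nn by (intro mult_right_mono mult_left_mono powr_five_eighths_le X Y YX' e) auto
    finally show "cmod (\<Sum>n = 1..nat \<lfloor>X\<rfloor>. \<Sum>m = 1..nat \<lfloor>Y\<rfloor>. a n * b m * A (int (n + m))) \<le>
             80 * C * L2_set (\<lambda>n. cmod (a n)) {1..nat \<lfloor>X\<rfloor>} *
                 L2_set (\<lambda>m. cmod (b m)) {1..nat \<lfloor>Y\<rfloor>} *
                 (X powr (3 / 8) / Y powr (3 / 4)) * (X * Y) powr (1 / 2 + \<epsilon>)"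
      unfolding P_def Q_def na_def nb_def by (simp add: mult_ac)
  qed (use C in simp)
next
  fix \<epsilon> X Y :: real
  assume X: "X \<ge> 1" and XY: "X powr (1 / 2) < Y"
  have "X powr (3 / 8) = (X powr (1 / 2)) powr (3 / 4)"
    by (simp add: powr_powr)
  also have "\<dots> < Y powr (3 / 4)"
    using XY by (intro powr_less_mono2) auto
  finally show "X powr (3 / 8) / Y powr (3 / 4) < 1"
    by (auto simp: divide_less_eq_1)
qed

end
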